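(* Let $S$ be a positively graded Noetherian ring with $S_0$ Artinian, let $M$ be a finitely generated graded $S$-module, and let $\mathcal I$ be a graded ideal of definition for $M$. Then the ordinary (ungraded) Samuel polynomial $p(M,\mathcal I,n)$ exists, ${}^*p(M,\mathcal I,n)=p(M,\mathcal I,n)$, and, for every $d$ (for which these multiplicities are defined), ${}^*e(M,\mathcal I,d)=e(M,\mathcal I,d)$.
   Context: All rings are commutative; "graded" means $\mathbb Z$-graded; $S$ is positively graded if $S_i=0$ for $i<0$. ${}^*\ell_S(M)$ is the length $n$ of a chain $0=M^0\subset\cdots\subset M^n=M$ of graded submodules whose successive quotients are *simple (nonzero with no nonzero proper graded submodule); it is independent of the chain, and is $\infty$ if no such chain exists. $\ell_S$ denotes ordinary length, forgetting gradings. A graded ideal of definition for $M$ is a proper graded ideal $\mathcal I$ with ${}^*\ell_S(M/\mathcal IM)<\infty$. Then ${}^*p(M,\mathcal I,n)$ is the unique polynomial in $\mathbb Q[n]$ equal to ${}^*\ell_S(M/\mathcal I^nM)$ for all $n\gg0$. The ungraded Samuel polynomial $p(M,\mathcal I,n)$ exists when $\ell_S(M/\mathcal IM)<\infty$ and is the unique polynomial equal to $\ell_S(M/\mathcal I^nM)$ for $n\gg0$. With $\Delta f(n)=f(n+1)-f(n)$, the multiplicities are ${}^*e(M,\mathcal I,d)=\Delta^d({}^*p(M,\mathcal I,n))$ for integers $d\ge0$ with $d\ge\deg{}^*p(M,\mathcal I,n)$, and $e(M,\mathcal I,d)=\Delta^d(p(M,\mathcal I,n))$ for integers $d\ge 0$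 with $d\ge\deg p(M,\mathcal I,n)$. *)

theory Defs
  imports
    "HOL-Computational_Algebra.Polynomial"
    "HOL-Library.Extended_Nat"
    "HOL-Algebra.Ring_Divisibility"
    "HOL-Algebra.Ideal_Product"
    "HOL-Algebra.Module"
begin

section \<open>Graded rings and modules\<close>

text \<open>Modules of HOL-Algebra are records extending rings, so the following two definitions apply
  to rings and to modules alike. Only the additive structure of \<open>G\<close> is used.\<close>

definition homogeneous_decomp ::
    "('a, 'm) ring_scheme \<Rightarrow> (int \<Rightarrow> 'a set) \<Rightarrow> 'a \<Rightarrow> (int \<Rightarrow> 'a) \<Rightarrow> bool" where
  "homogeneous_decomp G A x f \<longleftrightarrow>
     (\<forall>i. f i \<in> A i) \<and> finite {i. f i \<noteq> \<zero>\<^bsub>G\<^esub>} \<and> x = (\<Oplus>\<^bsub>G\<^esub>i\<in>{i. f i \<noteq> \<zero>\<^bsub>G\<^esub>}. f i)"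

definition direct_sum_decomp :: "('a, 'm) ring_scheme \<Rightarrow> (int \<Rightarrow> 'a set) \<Rightarrow> bool" where
  "direct_sum_decomp G A \<longleftrightarrow>
     (\<forall>i. additive_subgroup (A i) G) \<and> (\<forall>x\<in>carrier G. \<exists>!f. homogeneous_decomp G A x f)"

locale graded_ring = cring R for R (structure) and A +
  assumes ring_direct_sum: "direct_sum_decomp R A"
    and mult_degree: "\<lbrakk>x \<in> A i; y \<in> A j\<rbrakk> \<Longrightarrow> x \<otimes> y \<in> A (i + j)"

locale positively_graded_ring = graded_ring +
  assumes negative_degree: "i < 0 \<Longrightarrow> A i = {\<zero>}"

locale graded_module = graded_ring R A + Module.module R M
  for R (structure) and A and M (structure) and B +
  assumes module_direct_sum: "direct_sum_decomp M B"
    and smult_degree: "\<lbrakk>a \<in> A i; x \<in> B j\<rbrakk> \<Longrightarrow> a \<odot>\<^bsub>M\<^esub> x \<in> B (i + j)"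

text \<open>A submodule \<open>N\<close> is graded if it is the sum of its intersections with the
  homogeneous components of \<open>M\<close>; the sum is then automatically direct. Same for ideals.\<close>

definition graded_submodule ::
    "'b set \<Rightarrow> ('a, 'r) ring_scheme \<Rightarrow> ('a, 'b, 'm) module_scheme \<Rightarrow> (int \<Rightarrow> 'b set) \<Rightarrow> bool" where
  "graded_submodule N R M B \<longleftrightarrow>
     submodule N R M \<and> (\<forall>x\<in>N. \<exists>f. homogeneous_decomp M (\<lambda>i. N \<inter> B i) x f)"

definition graded_ideal :: "'a set \<Rightarrow> ('a, 'r) ring_scheme \<Rightarrow> (int \<Rightarrow> 'a set) \<Rightarrow> bool" where
  "graded_ideal I R A \<longleftrightarrow>
     ideal I R \<and> (\<forall>x\<in>I. \<exists>f. homogeneous_decomp R (\<lambda>i. I \<inter> A i) x f)"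

locale artinian_ring = ring +
  assumes descending_chain:
    "\<lbrakk>\<And>k::nat. ideal (C k) R; \<And>k. C (Suc k) \<subseteq> C k\<rbrakk> \<Longrightarrow> \<exists>n. \<forall>k\<ge>n. C k = C n"

definition finitely_generated_module ::
    "('a, 'r) ring_scheme \<Rightarrow> ('a, 'b, 'm) module_scheme \<Rightarrow> bool" where
  "finitely_generated_module R M \<longleftrightarrow>
     (\<exists>X. finite X \<and> X \<subseteq> carrier M \<and>
        (\<forall>y\<in>carrier M. \<exists>a\<in>X \<rightarrow> carrier R. y = (\<Oplus>\<^bsub>M\<^esub>x\<in>X. a x \<odot>\<^bsub>M\<^esub> x)))"


section \<open>Quotient modules\<close>

text \<open>The fields \<^const>\<open>mult\<close> and \<^const>\<open>one\<close> of a module record carry no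
  meaning for the module.\<close>

definition quot_module ::
    "('a, 'b, 'm) module_scheme \<Rightarrow> 'b set \<Rightarrow> ('a, 'b set) module" where
  "quot_module M N =
     \<lparr>carrier = a_rcosets\<^bsub>M\<^esub> N, mult = undefined, one = undefined, zero = N, add = set_add M,
      smult = (\<lambda>a X. \<Union>x\<in>X. N +>\<^bsub>M\<^esub> (a \<odot>\<^bsub>M\<^esub> x))\<rparr>"

definition quot_grading ::
    "('a, 'b, 'm) module_scheme \<Rightarrow> 'b set \<Rightarrow> (int \<Rightarrow> 'b set) \<Rightarrow> int \<Rightarrow> 'b set set" where
  "quot_grading M N B i = (\<lambda>x. N +>\<^bsub>M\<^esub> x) ` B i"

text \<open>The submodule \<open>I M\<close>: finite sums of products, in the style of \<^const>\<open>ideal_prod\<close>.\<close>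

inductive_set ideal_smult ::
    "('a, 'b, 'm) module_scheme \<Rightarrow> 'a set \<Rightarrow> 'b set" for M and I where
  prod: "\<lbrakk>a \<in> I; x \<in> carrier M\<rbrakk> \<Longrightarrow> a \<odot>\<^bsub>M\<^esub> x \<in> ideal_smult M I"
| sum: "\<lbrakk>x \<in> ideal_smult M I; y \<in> ideal_smult M I\<rbrakk> \<Longrightarrow> x \<oplus>\<^bsub>M\<^esub> y \<in> ideal_smult M I"

abbreviation ideal_power :: "('a, 'r) ring_scheme \<Rightarrow> 'a set \<Rightarrow> nat \<Rightarrow> 'a set" where
  "ideal_power R I n \<equiv> I [^]\<^bsub>ideals_set R\<^esub> n"


section \<open>Length and graded length\<close>

definition simple_module ::
    "('a, 'r) ring_scheme \<Rightarrow> ('a, 'b, 'm) module_scheme \<Rightarrow> bool" where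
  "simple_module R M \<longleftrightarrow> carrier M \<noteq> {\<zero>\<^bsub>M\<^esub>} \<and>
     (\<forall>N. submodule N R M \<longrightarrow> N = {\<zero>\<^bsub>M\<^esub>} \<or> N = carrier M)"

definition star_simple_module ::
    "('a, 'r) ring_scheme \<Rightarrow> ('a, 'b, 'm) module_scheme \<Rightarrow> (int \<Rightarrow> 'b set) \<Rightarrow> bool" where
  "star_simple_module R M B \<longleftrightarrow> carrier M \<noteq> {\<zero>\<^bsub>M\<^esub>} \<and>
     (\<forall>N. graded_submodule N R M B \<longrightarrow> N = {\<zero>\<^bsub>M\<^esub>} \<or> N = carrier M)"

definition composition_series ::
    "('a, 'r) ring_scheme \<Rightarrow> ('a, 'b, 'm) module_scheme \<Rightarrow> (nat \<Rightarrow> 'b set) \<Rightarrow> nat \<Rightarrow> bool" where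
  "composition_series R M C n \<longleftrightarrow>
     C 0 = {\<zero>\<^bsub>M\<^esub>} \<and> C n = carrier M \<and> (\<forall>k\<le>n. submodule (C k) R M) \<and>
     (\<forall>k<n. C k \<subset> C (Suc k) \<and>
        simple_module R (quot_module (M\<lparr>carrier := C (Suc k)\<rparr>) (C k)))"

definition star_composition_series ::
    "('a, 'r) ring_scheme \<Rightarrow> ('a, 'b, 'm) module_scheme \<Rightarrow> (int \<Rightarrow> 'b set) \<Rightarrow>
     (nat \<Rightarrow> 'b set) \<Rightarrow> nat \<Rightarrow> bool" where
  "star_composition_series R M B C n \<longleftrightarrow>
     C 0 = {\<zero>\<^bsub>M\<^esub>} \<and> C n = carrier M \<and> (\<forall>k\<le>n. graded_submodule (C k) R M B) \<and>
     (\<forall>k<n. C k \<subset> C (Suc k) \<and>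
        star_simple_module R (quot_module (M\<lparr>carrier := C (Suc k)\<rparr>) (C k))
          (quot_grading M (C k) (\<lambda>i. C (Suc k) \<inter> B i)))"

text \<open>The descriptions are justified by the Jordan--Hoelder theorem.\<close>

definition module_length ::
    "('a, 'r) ring_scheme \<Rightarrow> ('a, 'b, 'm) module_scheme \<Rightarrow> enat" where
  "module_length R M =
     (if \<exists>n C. composition_series R M C n
      then enat (THE n. \<exists>C. composition_series R M C n) else \<infinity>)"

definition star_length ::
    "('a, 'r) ring_scheme \<Rightarrow> ('a, 'b, 'm) module_scheme \<Rightarrow> (int \<Rightarrow> 'b set) \<Rightarrow> enat" where
  "star_length R M B =
     (if \<exists>n C. star_composition_series R M B C n
      then enat (THE n. \<exists>C. star_composition_series R M B C n) else \<infinity>)"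

abbreviation length_mod ::
    "('a, 'r) ring_scheme \<Rightarrow> ('a, 'b, 'm) module_scheme \<Rightarrow> 'a set \<Rightarrow> enat" where
  "length_mod R M I \<equiv> module_length R (quot_module M (ideal_smult M I))"

abbreviation star_length_mod ::
    "('a, 'r) ring_scheme \<Rightarrow> ('a, 'b, 'm) module_scheme \<Rightarrow> (int \<Rightarrow> 'b set) \<Rightarrow> 'a set \<Rightarrow> enat" where
  "star_length_mod R M B I \<equiv>
     star_length R (quot_module M (ideal_smult M I)) (quot_grading M (ideal_smult M I) B)"

definition graded_ideal_of_definition ::
    "('a, 'r) ring_scheme \<Rightarrow> (int \<Rightarrow> 'a set) \<Rightarrow> ('a, 'b, 'm) module_scheme \<Rightarrow> (int \<Rightarrow> 'b set) \<Rightarrow>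
     'a set \<Rightarrow> bool" where
  "graded_ideal_of_definition R A M B I \<longleftrightarrow>
     graded_ideal I R A \<and> I \<noteq> carrier R \<and> star_length_mod R M B I < \<infinity>"


section \<open>Samuel polynomials and multiplicities\<close>

definition eventually_poly :: "(nat \<Rightarrow> enat) \<Rightarrow> rat poly \<Rightarrow> bool" where
  "eventually_poly l p \<longleftrightarrow>
     (\<forall>\<^sub>F n in sequentially. \<exists>k. l n = enat k \<and> poly p (of_nat n) = of_nat k)"

definition is_samuel_poly ::
    "('a, 'r) ring_scheme \<Rightarrow> ('a, 'b, 'm) module_scheme \<Rightarrow> 'a set \<Rightarrow> rat poly \<Rightarrow> bool" where
  "is_samuel_poly R M I p \<longleftrightarrow> eventually_poly (\<lambda>n. length_mod R M (ideal_power R I n)) p"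

definition is_star_samuel_poly ::
    "('a, 'r) ring_scheme \<Rightarrow> ('a, 'b, 'm) module_scheme \<Rightarrow> (int \<Rightarrow> 'b set) \<Rightarrow> 'a set \<Rightarrow>
     rat poly \<Rightarrow> bool" where
  "is_star_samuel_poly R M B I p \<longleftrightarrow>
     eventually_poly (\<lambda>n. star_length_mod R M B (ideal_power R I n)) p"

definition samuel_poly ::
    "('a, 'r) ring_scheme \<Rightarrow> ('a, 'b, 'm) module_scheme \<Rightarrow> 'a set \<Rightarrow> rat poly" where
  "samuel_poly R M I = (THE p. is_samuel_poly R M I p)"

definition star_samuel_poly ::
    "('a, 'r) ring_scheme \<Rightarrow> ('a, 'b, 'm) module_scheme \<Rightarrow> (int \<Rightarrow> 'b set) \<Rightarrow> 'a set \<Rightarrow> rat poly" where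
  "star_samuel_poly R M B I = (THE p. is_star_samuel_poly R M B I p)"

definition poly_diff :: "rat poly \<Rightarrow> rat poly" where
  "poly_diff p = pcompose p [:1, 1:] - p"

text \<open>For \<open>d\<close> at least the degree, the \<open>d\<close>-th difference is a constant polynomial
  (lemma \<open>poly_diff_funpow_const\<close> below); the multiplicity is this constant.\<close>

definition multiplicity_e ::
    "('a, 'r) ring_scheme \<Rightarrow> ('a, 'b, 'm) module_scheme \<Rightarrow> 'a set \<Rightarrow> nat \<Rightarrow> rat" where
  "multiplicity_e R M I d = poly ((poly_diff ^^ d) (samuel_poly R M I)) 0"

definition star_multiplicity_e ::
    "('a, 'r) ring_scheme \<Rightarrow> ('a, 'b, 'm) module_scheme \<Rightarrow> (int \<Rightarrow> 'b set) \<Rightarrow> 'a set \<Rightarrow> nat \<Rightarrow> rat" where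
  "star_multiplicity_e R M B I d = poly ((poly_diff ^^ d) (star_samuel_poly R M B I)) 0"


section \<open>Well-definedness\<close>

lemma poly_poly_diff: "poly (poly_diff p) x = poly p (x + 1) - poly p x"
  by (simp add: poly_diff_def poly_pcompose add.commute)

lemma eventually_poly_unique:
  assumes "eventually_poly l p" "eventually_poly l q"
  shows "p = q"
proof (rule ccontr)
  assume "p \<noteq> q"
  then have fin: "finite {x. poly (p - q) x = 0}"
    by (intro poly_roots_finite) simp
  have "\<forall>\<^sub>F n in sequentially. poly (p - q) (of_nat n) = 0"
    using eventually_conj[OF assms[unfolded eventually_poly_def]]
    by (rule eventually_mono) auto
  then obtain N where N: "\<And>n. n \<ge> N \<Longrightarrow> poly (p - q) (of_nat n) = 0"
    by (auto simp: eventually_sequentially)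
  have "of_nat ` {N..} \<subseteq> {x. poly (p - q) x = 0}"
    using N by auto
  then have "finite ((of_nat :: nat \<Rightarrow> rat) ` {N..})"
    using fin finite_subset by blast
  then have "finite {N..}"
    by (rule finite_imageD) (simp add: inj_on_def)
  then show False
    by (simp add: infinite_Ici)
qed

lemma poly_diff_pCons: "poly_diff (pCons a p) = pcompose p [:1, 1:] + pCons 0 (poly_diff p)"
  by (simp add: poly_diff_def pcompose_pCons algebra_simps)

lemma degree_poly_diff: "degree p \<le> Suc d \<Longrightarrow> degree (poly_diff p) \<le> d"
proof (induction p arbitrary: d)
  case 0
  then show ?case by (simp add: poly_diff_def)
next
  case (pCons a p)
  show ?case
  proof (cases "p = 0")
    case True
    then show ?thesis by (simp add: poly_diff_def pcompose_pCons)
  next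
    case False
    then have le: "degree p \<le> d"
      using pCons.prems by simp
    have 1: "degree (pcompose p [:1, 1:]) \<le> d"
      using le by (simp add: degree_pcompose)
    have 2: "degree (pCons 0 (poly_diff p)) \<le> d"
    proof (cases d)
      case 0
      then obtain c where "p = [:c:]"
        using le degree_eq_zeroE by blast
      then show ?thesis by (simp add: poly_diff_def pcompose_pCons)
    next
      case (Suc d')
      then show ?thesis
        using pCons.IH[of d'] le by (auto intro: order_trans[OF degree_pCons_le])
    qed
    show ?thesis
      unfolding poly_diff_pCons by (rule degree_add_le[OF 1 2])
  qed
qed

lemma degree_poly_diff_funpow: "degree p \<le> d \<Longrightarrow> degree ((poly_diff ^^ d) p) = 0"
proof (induction d arbitrary: p)
  case (Suc d)
  then show ?case
    using degree_poly_diff[of p d] by (simp add: funpow_swap1)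
qed simp

lemma poly_diff_funpow_const:
  assumes "degree p \<le> d"
  shows "(poly_diff ^^ d) p = [:poly ((poly_diff ^^ d) p) 0:]"
proof -
  obtain c where "(poly_diff ^^ d) p = [:c:]"
    using degree_poly_diff_funpow[OF assms] degree_eq_zeroE by blast
  then show ?thesis by simp
qed

lemma (in Module.module) ideal_smult_submodule:
  assumes "ideal I R"
  shows "submodule (ideal_smult M I) R M"
proof -
  interpret I: ideal I R by fact
  have carr: "x \<in> carrier M" if "x \<in> ideal_smult M I" for x
    using that by induction (auto intro: I.Icarr)
  have smult: "a \<odot>\<^bsub>M\<^esub> x \<in> ideal_smult M I" if "x \<in> ideal_smult M I" "a \<in> carrier R" for a x
    using that
  proof (induction)
    case (prod b x)
    then have "(a \<otimes> b) \<odot>\<^bsub>M\<^esub> x \<in> ideal_smult M I"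
      by (intro ideal_smult.prod I.I_l_closed) auto
    then show ?case
      using prod I.Icarr by (simp add: smult_assoc1)
  next
    case (sum x y)
    then show ?case
      using carr by (simp add: smult_r_distr ideal_smult.sum)
  qed
  show ?thesis
  proof (rule submoduleI)
    show "\<zero>\<^bsub>M\<^esub> \<in> ideal_smult M I"
      using ideal_smult.prod[of \<zero> I "\<zero>\<^bsub>M\<^esub>" M] by simp
    show "\<ominus>\<^bsub>M\<^esub> x \<in> ideal_smult M I" if "x \<in> ideal_smult M I" for x
      using smult[OF that, of "\<ominus> \<one>"] carr[OF that] by (simp add: smult_l_minus)
  qed (auto intro: carr smult ideal_smult.sum)
qed

lemma (in Module.module) quot_module_smult:
  assumes "submodule N R M" "a \<in> carrier R" "x \<in> carrier M"
  shows "a \<odot>\<^bsub>quot_module M N\<^esub> (N +>\<^bsub>M\<^esub> x) = N +>\<^bsub>M\<^esub> (a \<odot>\<^bsub>M\<^esub> x)"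
proof -
  interpret N: submodule N R M by fact
  have N: "N \<subseteq> carrier M" "subgroup N (add_monoid M)"
    using N.subset N.subgroup_axioms by auto
  have "N +>\<^bsub>M\<^esub> (a \<odot>\<^bsub>M\<^esub> y) = N +>\<^bsub>M\<^esub> (a \<odot>\<^bsub>M\<^esub> x)" if y: "y \<in> N +>\<^bsub>M\<^esub> x" for y
  proof -
    obtain h where h: "h \<in> N" "y = h \<oplus>\<^bsub>M\<^esub> x"
      using y by (auto simp: a_r_coset_def')
    have hc: "h \<in> carrier M" using h N by auto
    have "a \<odot>\<^bsub>M\<^esub> y = a \<odot>\<^bsub>M\<^esub> h \<oplus>\<^bsub>M\<^esub> a \<odot>\<^bsub>M\<^esub> x"
      using assms h hc by (simp add: smult_r_distr)
    also have "\<dots> \<in> N +>\<^bsub>M\<^esub> (a \<odot>\<^bsub>M\<^esub> x)"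
      using assms h N by (intro M.a_rcosI) auto
    finally show ?thesis
      using M.a_repr_independence[of _ N "a \<odot>\<^bsub>M\<^esub> x"] assms N by auto
  qed
  moreover have "x \<in> N +>\<^bsub>M\<^esub> x"
    using M.a_rcosI[of "\<zero>\<^bsub>M\<^esub>" N x] N assms(3) subgroup.one_closed[OF N(2)] by simp
  ultimately have "(\<Union>y\<in>N +>\<^bsub>M\<^esub> x. N +>\<^bsub>M\<^esub> (a \<odot>\<^bsub>M\<^esub> y)) = N +>\<^bsub>M\<^esub> (a \<odot>\<^bsub>M\<^esub> x)"
    by blast
  then show ?thesis
    by (simp add: quot_module_def)
qed

lemma (in Module.module) quot_module_is_module:
  assumes "submodule N R M"
  shows "Module.module R (quot_module M N)"
proof -
  interpret N: submodule N R M by fact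
  interpret AN: abelian_subgroup N M
    by (rule abelian_subgroupI3)
      (auto intro: additive_subgroup.intro N.subgroup_axioms M.abelian_group_axioms)
  have cosets: "X \<in> carrier (quot_module M N) \<longleftrightarrow> (\<exists>x\<in>carrier M. X = N +>\<^bsub>M\<^esub> x)" for X
    by (auto simp: quot_module_def A_RCOSETS_def')
  have add: "(N +>\<^bsub>M\<^esub> x) \<oplus>\<^bsub>quot_module M N\<^esub> (N +>\<^bsub>M\<^esub> y) = N +>\<^bsub>M\<^esub> (x \<oplus>\<^bsub>M\<^esub> y)"
    if "x \<in> carrier M" "y \<in> carrier M" for x y
    using that AN.a_rcos_sum by (simp add: quot_module_def)
  have zero: "\<zero>\<^bsub>quot_module M N\<^esub> = N +>\<^bsub>M\<^esub> \<zero>\<^bsub>M\<^esub>"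
    using AN.a_subset by (simp add: quot_module_def)
  have ag: "abelian_group (quot_module M N)"
  proof (rule abelian_groupI)
    fix X assume "X \<in> carrier (quot_module M N)"
    then obtain x where x: "x \<in> carrier M" "X = N +>\<^bsub>M\<^esub> x"
      by (auto simp: cosets)
    then have "(N +>\<^bsub>M\<^esub> (\<ominus>\<^bsub>M\<^esub> x)) \<oplus>\<^bsub>quot_module M N\<^esub> X = \<zero>\<^bsub>quot_module M N\<^esub>"
      by (simp add: add zero M.l_neg)
    then show "\<exists>Y\<in>carrier (quot_module M N). Y \<oplus>\<^bsub>quot_module M N\<^esub> X = \<zero>\<^bsub>quot_module M N\<^esub>"
      using x(1) cosets by blast
  next
    fix X Y assume "X \<in> carrier (quot_module M N)" "Y \<in> carrier (quot_module M N)"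
    then show "X \<oplus>\<^bsub>quot_module M N\<^esub> Y \<in> carrier (quot_module M N)"
      unfolding cosets by (metis add M.a_closed)
  next
    show "\<zero>\<^bsub>quot_module M N\<^esub> \<in> carrier (quot_module M N)"
      using cosets zero by blast
  qed (auto simp: cosets add zero M.a_ac simp del: M.a_coset_add_zero)
  note sm = quot_module_smult[OF assms]
  show ?thesis
  proof (rule moduleI[OF R.is_cring ag])
    fix a X assume "a \<in> carrier R" "X \<in> carrier (quot_module M N)"
    then show "a \<odot>\<^bsub>quot_module M N\<^esub> X \<in> carrier (quot_module M N)"
      unfolding cosets by (metis sm smult_closed)
  next
    fix a b X assume "a \<in> carrier R" "b \<in> carrier R" "X \<in> carrier (quot_module M N)"
    then show "(a \<oplus> b) \<odot>\<^bsub>quot_module M N\<^esub> X =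
        a \<odot>\<^bsub>quot_module M N\<^esub> X \<oplus>\<^bsub>quot_module M N\<^esub> b \<odot>\<^bsub>quot_module M N\<^esub> X"
      by (auto simp: cosets sm add smult_l_distr)
  next
    fix a X Y
    assume "a \<in> carrier R" "X \<in> carrier (quot_module M N)" "Y \<in> carrier (quot_module M N)"
    then show "a \<odot>\<^bsub>quot_module M N\<^esub> (X \<oplus>\<^bsub>quot_module M N\<^esub> Y) =
        a \<odot>\<^bsub>quot_module M N\<^esub> X \<oplus>\<^bsub>quot_module M N\<^esub> a \<odot>\<^bsub>quot_module M N\<^esub> Y"
      by (auto simp: cosets sm add smult_r_distr)
  next
    fix a b X assume "a \<in> carrier R" "b \<in> carrier R" "X \<in> carrier (quot_module M N)"
    then show "(a \<otimes> b) \<odot>\<^bsub>quot_module M N\<^esub> X =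
        a \<odot>\<^bsub>quot_module M N\<^esub> (b \<odot>\<^bsub>quot_module M N\<^esub> X)"
      by (auto simp: cosets sm smult_assoc1)
  next
    fix X assume "X \<in> carrier (quot_module M N)"
    then show "\<one> \<odot>\<^bsub>quot_module M N\<^esub> X = X"
      by (auto simp: cosets sm)
  qed
qed

end

theory Submission
  imports Defs "HOL-Library.List_Lexorder"
begin

text \<open>
  If \<open>N \<subset> P\<close> are graded submodules with nothing graded strictly between, then \<open>P / N\<close> is
  concentrated in a single degree, because the part of \<open>P\<close> above the degree of a homogeneous
  \<open>x \<in> P - N\<close> together with \<open>N\<close> spans a graded submodule that misses \<open>x\<close>. A submodule
  between \<open>N\<close> and \<open>P\<close> other than \<open>N\<close> therefore contains a homogeneous element outside \<open>N\<close>, hence is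
  \<open>P\<close>. So graded composition series are composition series, and the two lengths agree.

  The Samuel function is eventually polynomial by a count of monomials. Let \<open>a\<^sub>1, \<dots>, a\<^sub>r\<close> generate
  \<open>I\<close>, and for an exponent vector \<open>u\<close> of degree \<open>n\<close> let \<open>J\<^sub>u\<close> be the set of \<open>m \<in> M\<close> such that
  \<open>a\<^sup>u m\<close> lies in \<open>I\<^sup>n\<^sup>+\<^sup>1 M\<close> plus the \<open>a\<^sup>v M\<close> with \<open>v\<close> of degree \<open>n\<close> and lexicographically smaller
  than \<open>u\<close>. Then \<open>I\<^sup>n M / I\<^sup>n\<^sup>+\<^sup>1 M\<close> has a filtration with factors \<open>M / J\<^sub>u\<close>. Since \<open>J\<^sub>u\<close> grows with
  \<open>u\<close>, the length of \<open>M / J\<^sub>u\<close> is an antitone function of \<open>u\<close>, and the sum of any antitone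
  \<open>\<nat>\<close>-valued function over the exponent vectors of degree \<open>n\<close> is eventually a polynomial in \<open>n\<close>.
\<close>

subsection \<open>Eventually polynomial functions\<close>

lemma pcompose_monom_one: "pcompose (Polynomial.monom 1 n) q = q ^ n"
  by (induction n) (simp_all add: monom_Suc pcompose_pCons pcompose_1)

text \<open>Discrete antidifferentiation, by induction on the degree: the difference of
  \<open>c x^(d+1) / (d+1)\<close> has leading term \<open>c x^d\<close>, so subtracting it cancels
  the leading term of \<open>p\<close>.\<close>

lemma poly_diff_surj: "\<exists>q. poly_diff q = p"
proof (induction "degree p" arbitrary: p rule: less_induct)
  case less
  show ?case
  proof (cases "p = 0")
    case True
    then show ?thesis by (intro exI[of _ 0]) (simp add: poly_diff_def)
  next
    case False
    define d where "d = degree p"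
    define m where "m = Polynomial.smult (lead_coeff p / of_nat (Suc d)) (Polynomial.monom 1 (Suc d))"
    have eq: "poly_diff m = Polynomial.smult (lead_coeff p / of_nat (Suc d)) ([:1, 1:] ^ Suc d - Polynomial.monom 1 (Suc d))"
      by (simp add: m_def poly_diff_def pcompose_smult pcompose_monom_one smult_diff_right del: power_Suc)
    have "Polynomial.coeff (poly_diff m) d = lead_coeff p"
      unfolding eq by (simp add: coeff_linear_poly_power del: power_Suc of_nat_Suc)
    moreover have "degree (poly_diff m) \<le> d"
      by (rule degree_poly_diff) (auto simp: m_def intro: order_trans[OF degree_smult_le] degree_monom_le)
    ultimately have c: "Polynomial.coeff (p - poly_diff m) d = 0" and le: "degree (p - poly_diff m) \<le> d"
      by (auto simp: d_def intro: degree_diff_le)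
    \<comment> \<open>In degree 0 the degree cannot drop any further; there the vanishing
      coefficient makes the remainder zero outright.\<close>
    obtain q where "poly_diff q = p - poly_diff m"
    proof (cases "d = 0")
      case True
      with c le have "p - poly_diff m = 0"
        by (metis degree_0_id le_zero_eq pCons_0_0)
      then show ?thesis using that[of 0] by (simp add: poly_diff_def)
    next
      case False
      with c le have "degree (p - poly_diff m) < d"
        by (metis degree_0 eq_zero_or_degree_less gr_zeroI)
      then show ?thesis using less[of "p - poly_diff m"] that by (auto simp: d_def)
    qed
    then have "poly_diff (q + m) = p"
      by (simp add: poly_diff_def pcompose_add algebra_simps)
    then show ?thesis ..
  qed
qed

text \<open>The counterpart of \<open>eventually_poly\<close> for finite values, with the polynomial
  hidden: the closure properties below concern only its existence.\<close>

definition eventually_polynomial :: "(nat \<Rightarrow> nat) \<Rightarrow> bool" where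
  "eventually_polynomial f \<longleftrightarrow> (\<exists>p::rat poly. \<forall>\<^sub>F n in sequentially. poly p (of_nat n) = of_nat (f n))"

lemma eventually_polynomialI:
  assumes "\<And>n. n \<ge> N \<Longrightarrow> poly p (of_nat n) = (of_nat (f n) :: rat)"
  shows "eventually_polynomial f"
  using assms unfolding eventually_polynomial_def eventually_sequentially by blast

lemma eventually_polynomial_cong:
  assumes "eventually_polynomial f" and "\<And>n. n \<ge> N \<Longrightarrow> f n = g n"
  shows "eventually_polynomial g"
proof -
  obtain p N' where p: "\<forall>n\<ge>N'. poly p (of_nat n) = (of_nat (f n) :: rat)"
    using assms(1) unfolding eventually_polynomial_def eventually_sequentially by blast
  show ?thesis
    by (rule eventually_polynomialI[of "max N N'" p]) (use p assms(2) in auto)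
qed

lemma eventually_polynomial_add:
  assumes "eventually_polynomial f" "eventually_polynomial g"
  shows "eventually_polynomial (\<lambda>n. f n + g n)"
proof -
  obtain p N where p: "\<forall>n\<ge>N. poly p (of_nat n) = (of_nat (f n) :: rat)"
    using assms(1) unfolding eventually_polynomial_def eventually_sequentially by blast
  obtain q N' where q: "\<forall>n\<ge>N'. poly q (of_nat n) = (of_nat (g n) :: rat)"
    using assms(2) unfolding eventually_polynomial_def eventually_sequentially by blast
  show ?thesis
    by (rule eventually_polynomialI[of "max N N'" "p + q"]) (use p q in auto)
qed

lemma eventually_polynomial_zero: "eventually_polynomial (\<lambda>n. 0)"
  by (rule eventually_polynomialI[of 0 0]) simp

lemma eventually_polynomial_sum:
  assumes "finite K" "\<And>k. k \<in> K \<Longrightarrow> eventually_polynomial (f k)"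
  shows "eventually_polynomial (\<lambda>n. \<Sum>k\<in>K. f k n)"
  using assms
proof (induction K)
  case (insert k K)
  then have "eventually_polynomial (\<lambda>n. f k n + (\<Sum>k\<in>K. f k n))"
    by (intro eventually_polynomial_add) simp_all
  with insert show ?case by simp
qed (simp add: eventually_polynomial_zero)

text \<open>Truncated subtraction is harmless, since the values with \<open>n < k\<close> are
  discarded.\<close>

lemma eventually_polynomial_shift:
  assumes "eventually_polynomial f"
  shows "eventually_polynomial (\<lambda>n. f (n - k))"
proof -
  obtain p N where p: "\<forall>n\<ge>N. poly p (of_nat n) = (of_nat (f n) :: rat)"
    using assms unfolding eventually_polynomial_def eventually_sequentially by blast
  show ?thesis
  proof (rule eventually_polynomialI[of "N + k" "pcompose p [:- of_nat k, 1:]"])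
    fix n assume "n \<ge> N + k"
    then show "poly (pcompose p [:- of_nat k, 1:]) (of_nat n) = of_nat (f (n - k))"
      using p[THEN spec, of "n - k"] by (simp add: poly_pcompose of_nat_diff)
  qed
qed

lemma eventually_polynomial_partial_sums:
  assumes "eventually_polynomial f"
  shows "eventually_polynomial (\<lambda>n. \<Sum>i<n. f i)"
proof -
  obtain p N where p: "\<forall>n\<ge>N. poly p (of_nat n) = (of_nat (f n) :: rat)"
    using assms unfolding eventually_polynomial_def eventually_sequentially by blast
  obtain q where q: "poly_diff q = p" using poly_diff_surj by blast
  \<comment> \<open>The added constant makes \<open>?q\<close> agree with the partial sum at
    \<open>N\<close>; it absorbs the values of \<open>f\<close> below \<open>N\<close>, which need
    not follow the polynomial \<open>p\<close>.\<close>
  let ?q = "q + [:of_nat (\<Sum>i<N. f i) - poly q (of_nat N):]"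
  show ?thesis
  proof (rule eventually_polynomialI[of N ?q])
    fix n assume "n \<ge> N"
    then show "poly ?q (of_nat n) = of_nat (\<Sum>i<n. f i)"
    proof (induction n rule: dec_induct)
      case (step n)
      have "poly q (of_nat n + 1) = poly q (of_nat n) + of_nat (f n)"
        using p step(1) poly_poly_diff[of q "of_nat n"] by (auto simp: q)
      with step.IH show ?case by (simp add: add.commute)
    qed simp
  qed
qed

section \<open>Sums of antitone functions over exponent vectors\<close>

definition antitone_lists :: "nat \<Rightarrow> (nat list \<Rightarrow> nat) \<Rightarrow> bool" where
  "antitone_lists r f \<longleftrightarrow> (\<forall>u v. length u = r \<longrightarrow> list_all2 (\<le>) u v \<longrightarrow> f v \<le> f u)"

lemma antitone_listsD:
  "antitone_lists r f \<Longrightarrow> length u = r \<Longrightarrow> list_all2 (\<le>) u v \<Longrightarrow> f v \<le> f u"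
  by (auto simp: antitone_lists_def)

lemma nat_decseq_stabilizes:
  fixes f :: "nat \<Rightarrow> nat"
  assumes "\<And>i j. i \<le> j \<Longrightarrow> f j \<le> f i"
  shows "\<exists>J. \<forall>j\<ge>J. f j = f J"
proof -
  obtain J where "\<forall>i. f J \<le> f i"
    using ex_has_least_nat[of "\<lambda>_. True" 0 f] by auto
  then show ?thesis using assms by (metis le_antisym)
qed

text \<open>Stability of the diagonal \<open>F j (j # v)\<close> takes care of all large first
  coordinates at once; only finitely many slices remain.\<close>

lemma antitone_lists_stabilize:
  fixes F :: "nat \<Rightarrow> nat list \<Rightarrow> nat"
  assumes "\<And>i j u v. length u = r \<Longrightarrow> i \<le> j \<Longrightarrow> list_all2 (\<le>) u v \<Longrightarrow> F j v \<le> F i u"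
  shows "\<exists>J. \<forall>j\<ge>J. \<forall>u. length u = r \<longrightarrow> F j u = F J u"
  using assms
proof (induction r arbitrary: F)
  case 0
  then show ?case
    using nat_decseq_stabilizes[of "\<lambda>j. F j []"] by auto
next
  case (Suc r)
  have mono: "F j (l # v) \<le> F i (k # u)"
    if "length u = r" "i \<le> j" "k \<le> l" "list_all2 (\<le>) u v" for i j k l u v
    using Suc.prems[of "k # u" i j "l # v"] that by simp
  have refl: "list_all2 (\<le>) u u" for u :: "nat list"
    by (simp add: list_all2_refl)
  obtain J where J: "\<And>j u. j \<ge> J \<Longrightarrow> length u = r \<Longrightarrow> F j (j # u) = F J (J # u)"
    using Suc.IH[of "\<lambda>j u. F j (j # u)"] mono by blast
  have "\<exists>K. \<forall>j\<ge>K. \<forall>u. length u = r \<longrightarrow> F j (k # u) = F K (k # u)" for k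
    by (rule Suc.IH) (use mono in auto)
  then obtain K where K: "\<And>k j u. j \<ge> K k \<Longrightarrow> length u = r \<Longrightarrow> F j (k # u) = F (K k) (k # u)"
    by metis
  \<comment> \<open>\<open>J\<close> settles all slices with first coordinate at least
    \<open>J\<close>; each of the finitely many slices \<open>k < J\<close> contributes its own
    stabilization index \<open>K k\<close>.\<close>
  define J' where "J' = Max (insert J (K ` {..<J}))"
  have J': "J \<le> J'" "\<And>k. k < J \<Longrightarrow> K k \<le> J'"
    by (auto simp: J'_def)
  have "F j u = F J' u" if j: "j \<ge> J'" and u: "length u = Suc r" for j u
  proof -
    obtain k w where kw: "u = k # w" "length w = r"
      using u by (cases u) auto
    \<comment> \<open>Antitonicity squeezes the value between the diagonal values at
      \<open>max i k\<close> and at \<open>J\<close>, and these two coincide.\<close>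
    have big: "F i (k # w) = F J (J # w)" if "i \<ge> J" "k \<ge> J" for i
    proof (rule antisym)
      show "F i (k # w) \<le> F J (J # w)" using mono that kw refl by auto
      have "F (max i k) (max i k # w) \<le> F i (k # w)" using mono that kw refl by auto
      then show "F J (J # w) \<le> F i (k # w)" using J[of "max i k" w] that kw by auto
    qed
    show ?thesis
    proof (cases "k < J")
      case True
      then have "K k \<le> J'" "K k \<le> j" using J'(2)[of k] j by auto
      then show ?thesis using K[of k j w] K[of k J' w] kw by simp
    next
      case False
      then show ?thesis using big[of j] big[of J'] J' j kw by auto
    qed
  qed
  then show ?case by blast
qed

definition exponents :: "nat \<Rightarrow> nat \<Rightarrow> nat list set" where
  "exponents r n = {u. length u = r \<and> sum_list u = n}"

lemma exponents_Suc: "exponents (Suc r) n = (\<Union>j\<le>n. (#) j ` exponents r (n - j))"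
proof (intro equalityI subsetI)
  fix u assume "u \<in> exponents (Suc r) n"
  then obtain j w where "u = j # w" "length w = r" "j + sum_list w = n"
    by (cases u) (auto simp: exponents_def)
  then show "u \<in> (\<Union>j\<le>n. (#) j ` exponents r (n - j))"
    by (intro UN_I[of j] image_eqI[of _ _ w]) (auto simp: exponents_def)
qed (auto simp: exponents_def)

lemma finite_exponents: "finite (exponents r n)"
proof (induction r arbitrary: n)
  case 0
  have "exponents 0 n \<subseteq> {[]}" by (auto simp: exponents_def)
  then show ?case by (rule finite_subset) simp
qed (auto simp: exponents_Suc)

lemma sum_exponents_Suc:
  "(\<Sum>u\<in>exponents (Suc r) n. f u) = (\<Sum>j\<le>n. \<Sum>u\<in>exponents r (n - j). f (j # u))"
  unfolding exponents_Suc
  by (subst sum.UNION_disjoint) (auto simp: finite_exponents sum.reindex inj_on_def)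

text \<open>Induction on the number of coordinates, splitting off the first one, \<open>j\<close>.
  From some \<open>J\<close> on the slices no longer depend on \<open>j\<close> and together give a
  partial sum of the single function \<open>H J\<close>; the finitely many earlier slices are
  shifted eventually polynomial functions.\<close>

lemma eventually_polynomial_sum_exponents:
  assumes "antitone_lists r f"
  shows "eventually_polynomial (\<lambda>n. \<Sum>u\<in>exponents r n. f u)"
  using assms
proof (induction r arbitrary: f)
  case 0
  \<comment> \<open>The empty vector has degree 0, so with no coordinates the sum is zero from
    \<open>n = 1\<close> on.\<close>
  have "exponents 0 n = {}" if "n \<ge> 1" for n
    using that by (auto simp: exponents_def)
  then show ?case
    by (intro eventually_polynomial_cong[OF eventually_polynomial_zero, of 1]) simp
next
  case (Suc r)
  define g where "g j u = f (j # u)" for j u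
  define H where "H j n = (\<Sum>u\<in>exponents r n. g j u)" for j n
  have g: "g j v \<le> g i u" if "length u = r" "i \<le> j" "list_all2 (\<le>) u v" for i j u v
    using antitone_listsD[OF Suc.prems, of "i # u" "j # v"] that by (simp add: g_def)
  have H: "eventually_polynomial (H j)" for j
    unfolding H_def by (rule Suc.IH) (use g in \<open>auto simp: antitone_lists_def\<close>)
  obtain J where J: "\<And>j u. j \<ge> J \<Longrightarrow> length u = r \<Longrightarrow> g j u = g J u"
    using antitone_lists_stabilize[of r g] g by blast
  have HJ: "H j n = H J n" if "j \<ge> J" for j n
    unfolding H_def by (rule sum.cong) (use J[OF that] in \<open>auto simp: exponents_def\<close>)
  show ?case
  proof (rule eventually_polynomial_cong)
    show "eventually_polynomial (\<lambda>n. (\<Sum>j<J. H j (n - j)) + (\<Sum>i<n + 1 - J. H J i))"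
    proof (intro eventually_polynomial_add eventually_polynomial_sum)
      \<comment> \<open>The range \<open>i < n + 1 - J\<close> is the range \<open>i < n - J\<close>
        plus one last term, which is correct once \<open>n \<ge> J\<close>.\<close>
      have "eventually_polynomial (\<lambda>n. \<Sum>i<n - J. H J i)"
        by (rule eventually_polynomial_shift[of "\<lambda>n. \<Sum>i<n. H J i" J,
              OF eventually_polynomial_partial_sums[OF H]])
      from eventually_polynomial_add[OF this eventually_polynomial_shift[of "H J" J, OF H]]
      show "eventually_polynomial (\<lambda>n. \<Sum>i<n + 1 - J. H J i)"
        by (rule eventually_polynomial_cong[of _ J]) (simp add: Suc_diff_le)
      show "eventually_polynomial (\<lambda>n. H j (n - j))" for j
        by (rule eventually_polynomial_shift[OF H])
    qed simp
    fix n assume n: "n \<ge> J"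
    have "(\<Sum>u\<in>exponents (Suc r) n. f u) = (\<Sum>j\<le>n. H j (n - j))"
      by (simp add: sum_exponents_Suc H_def g_def)
    also have "{..n} = {..<J} \<union> {J..n}" using n by auto
    also have "(\<Sum>j\<in>{..<J} \<union> {J..n}. H j (n - j)) = (\<Sum>j<J. H j (n - j)) + (\<Sum>j\<in>{J..n}. H j (n - j))"
      by (rule sum.union_disjoint) auto
    also have "(\<Sum>j\<in>{J..n}. H j (n - j)) = (\<Sum>j\<in>{J..n}. H J (n - j))"
      by (rule sum.cong[OF refl HJ]) simp
    also have "\<dots> = (\<Sum>i<n + 1 - J. H J i)"
      by (rule sum.reindex_bij_witness[of _ "\<lambda>i. n - i" "\<lambda>j. n - j"]) auto
    finally show "(\<Sum>j<J. H j (n - j)) + (\<Sum>i<n + 1 - J. H J i) = (\<Sum>u\<in>exponents (Suc r) n. f u)"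
      by (rule sym)
  qed
qed

subsection \<open>Saturated chains of submodules\<close>

definition covers :: "'a set set \<Rightarrow> 'a set \<Rightarrow> 'a set \<Rightarrow> bool" where
  "covers L P Q \<longleftrightarrow> P \<in> L \<and> Q \<in> L \<and> P \<subset> Q \<and> (\<forall>Y\<in>L. P \<subseteq> Y \<longrightarrow> Y \<subseteq> Q \<longrightarrow> Y = P \<or> Y = Q)"

text \<open>The family \<open>L\<close> is a parameter so that all submodules and the graded
  submodules share the same theory. Chains grow upwards from the fixed bottom \<open>N\<close>, one
  cover at a time.\<close>

inductive has_length :: "'a set set \<Rightarrow> 'a set \<Rightarrow> 'a set \<Rightarrow> nat \<Rightarrow> bool" for L where
  base: "N \<in> L \<Longrightarrow> has_length L N N 0"
| step: "has_length L N P n \<Longrightarrow> covers L P Q \<Longrightarrow> has_length L N Q (Suc n)"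

lemma has_length_mem:
  assumes "has_length L N P n"
  shows "N \<in> L" "P \<in> L" "N \<subseteq> P"
  using assms by (induction) (auto simp: covers_def)

lemma has_length_trans:
  assumes "has_length L N P n" "has_length L P Q m"
  shows "has_length L N Q (n + m)"
  using assms(2,1)
  by (induction rule: has_length.induct) (auto intro: has_length.step)

lemma has_length_covers: "covers L P Q \<Longrightarrow> has_length L P Q 1"
  using has_length.step[OF has_length.base, of P L Q] by (simp add: covers_def)

text \<open>Connects the inductive chains with the indexed ones occurring in composition
  series.\<close>

lemma has_length_iff_chain:
  "has_length L N P n \<longleftrightarrow>
    (\<exists>C. C 0 = N \<and> C n = P \<and> (\<forall>k\<le>n. C k \<in> L) \<and> (\<forall>k<n. covers L (C k) (C (Suc k))))"
    (is "_ \<longleftrightarrow> ?R P n")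
proof
  show "?R P n" if "has_length L N P n"
    using that
  proof induction
    case (base N)
    then show ?case by (intro exI[of _ "\<lambda>_. N"]) simp
  next
    case (step N P n Q)
    then obtain C where "C 0 = N" "C n = P" "\<forall>k\<le>n. C k \<in> L" "\<forall>k<n. covers L (C k) (C (Suc k))"
      by auto
    with step.hyps show ?case
      by (intro exI[of _ "C(Suc n := Q)"]) (auto simp: covers_def less_Suc_eq le_Suc_eq)
  qed
  show "has_length L N P n" if chain: "?R P n"
  proof -
    obtain C where C: "C 0 = N" "C n = P" "\<forall>k\<le>n. C k \<in> L" "\<forall>k<n. covers L (C k) (C (Suc k))"
      using chain by auto
    have "has_length L N (C k) k" if "k \<le> n" for k
      using that
    proof (induction k)
      case 0
      then show ?case using C by (auto intro: has_length.base)
    next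
      case (Suc k)
      then show ?case using C by (auto intro: has_length.step)
    qed
    then show ?thesis using C by auto
  qed
qed

section \<open>Rank functions as witnesses of finite length\<close>

text \<open>A strictly monotone function to the naturals on the interval from \<open>N\<close> to
  \<open>P\<close> bounds the length of every chain there. Unlike a saturated chain, it restricts to
  any subfamily of \<open>L\<close>.\<close>

definition rank_on :: "'a set set \<Rightarrow> 'a set \<Rightarrow> 'a set \<Rightarrow> ('a set \<Rightarrow> nat) \<Rightarrow> bool" where
  "rank_on L N P h \<longleftrightarrow>
    (\<forall>X\<in>L. \<forall>Y\<in>L. N \<subseteq> X \<longrightarrow> X \<subset> Y \<longrightarrow> Y \<subseteq> P \<longrightarrow> h X < h Y)"

lemma rank_onD:
  "rank_on L N P h \<Longrightarrow> X \<in> L \<Longrightarrow> Y \<in> L \<Longrightarrow> N \<subseteq> X \<Longrightarrow> X \<subset> Y \<Longrightarrow> Y \<subseteq> P \<Longrightarrow> h X < h Y"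
  unfolding rank_on_def by blast

lemma rank_on_mono:
  "rank_on L N P h \<Longrightarrow> L' \<subseteq> L \<Longrightarrow> N \<subseteq> N' \<Longrightarrow> P' \<subseteq> P \<Longrightarrow> rank_on L' N' P' h"
  unfolding rank_on_def by (meson order_trans subsetD)

text \<open>Each cover in the chain raises the rank by at least one.\<close>

lemma has_length_le_rank:
  assumes "has_length L N P n" "rank_on L N P h"
  shows "h N + n \<le> h P"
  using assms
proof induction
  case (step N P n Q)
  have PQ: "P \<in> L" "Q \<in> L" "P \<subset> Q" "N \<subseteq> P"
    using step.hyps(2) has_length_mem(3)[OF step.hyps(1)] by (auto simp: covers_def)
  have "h N + n \<le> h P"
    by (rule step.IH) (rule rank_on_mono[OF step.prems], use PQ in auto)
  moreover have "h P < h Q"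
    by (rule rank_onD[OF step.prems]) (use PQ in auto)
  ultimately show ?case by simp
qed simp

text \<open>Induction on the difference of the ranks at the two ends: an intermediate member splits
  the interval into two with smaller rank difference, and the two chains are concatenated.\<close>

lemma has_length_exists:
  assumes "N \<in> L" "P \<in> L" "N \<subseteq> P" "rank_on L N P h"
  shows "\<exists>n. has_length L N P n"
  using assms
proof (induction "h P - h N" arbitrary: N P rule: less_induct)
  case less
  note rank = less.prems(4)
  consider "N = P" | "covers L N P" | Y where "Y \<in> L" "N \<subset> Y" "Y \<subset> P"
    using less.prems(1-3) unfolding covers_def by blast
  then show ?case
  proof cases
    case 1
    then show ?thesis using less.prems(1) by (auto intro: has_length.base)
  next
    case 2
    then show ?thesis by (auto intro: has_length_covers)
  next
    case 3
    have h: "h N < h Y" "h Y < h P"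
      using rank_onD[OF rank, of N Y] rank_onD[OF rank, of Y P] 3 less.prems(1-3) by auto
    have "\<exists>n. has_length L N Y n"
      by (rule less.hyps) (use h 3 less.prems(1-3) rank_on_mono[OF rank, of L N Y] in auto)
    moreover have "\<exists>n. has_length L Y P n"
      by (rule less.hyps) (use h 3 less.prems(1-3) rank_on_mono[OF rank, of L Y P] in auto)
    ultimately show ?thesis using has_length_trans by blast
  qed
qed

text \<open>Length depends only on the order type of the interval. This transports chains along
  multiplication by a scalar and along the projection to a quotient.\<close>

lemma has_length_order_iso:
  assumes "has_length L N P n"
    and closed: "\<And>X. X \<in> L \<Longrightarrow> N \<subseteq> X \<Longrightarrow> X \<subseteq> P \<Longrightarrow> \<phi> X \<in> L'"
    and mono: "\<And>X Y. X \<in> L \<Longrightarrow> Y \<in> L \<Longrightarrow> N \<subseteq> X \<Longrightarrow> X \<subseteq> P \<Longrightarrow> N \<subseteq> Y \<Longrightarrow> Y \<subseteq> P \<Longrightarrow>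
      \<phi> X \<subseteq> \<phi> Y \<longleftrightarrow> X \<subseteq> Y"
    and surj: "\<And>Z. Z \<in> L' \<Longrightarrow> \<phi> N \<subseteq> Z \<Longrightarrow> Z \<subseteq> \<phi> P \<Longrightarrow> \<exists>X\<in>L. N \<subseteq> X \<and> X \<subseteq> P \<and> \<phi> X = Z"
  shows "has_length L' (\<phi> N) (\<phi> P) n"
  using assms
proof (induction)
  case (base N)
  then show ?case by (auto intro: has_length.base)
next
  case (step N P n Q)
  note mem = has_length_mem[OF step.hyps(1)]
  have PQ: "P \<in> L" "Q \<in> L" "P \<subset> Q" "N \<subseteq> P" "N \<in> L"
    and cov: "\<And>Y. Y \<in> L \<Longrightarrow> P \<subseteq> Y \<Longrightarrow> Y \<subseteq> Q \<Longrightarrow> Y = P \<or> Y = Q"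
    using step.hyps(2) mem by (auto simp: covers_def)
  have le: "\<phi> P \<subseteq> \<phi> Q" using step.prems(2)[of P Q] PQ by auto
  have "has_length L' (\<phi> N) (\<phi> P) n"
  proof (rule step.IH)
    \<comment> \<open>A preimage found below \<open>Q\<close> already lies below \<open>P\<close>,
      because \<open>\<phi>\<close> reflects inclusions.\<close>
    fix Z assume Z: "Z \<in> L'" "\<phi> N \<subseteq> Z" "Z \<subseteq> \<phi> P"
    then obtain X where X: "X \<in> L" "N \<subseteq> X" "X \<subseteq> Q" "\<phi> X = Z"
      using step.prems(3)[of Z] le by blast
    then have "X \<subseteq> P" using step.prems(2)[of X P] PQ Z by auto
    with X show "\<exists>X\<in>L. N \<subseteq> X \<and> X \<subseteq> P \<and> \<phi> X = Z" by blast
  qed (use step.prems PQ in auto)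
  moreover have "covers L' (\<phi> P) (\<phi> Q)"
    unfolding covers_def
  proof (intro conjI ballI impI)
    show "\<phi> P \<in> L'" "\<phi> Q \<in> L'" using step.prems(1) PQ by auto
    show "\<phi> P \<subset> \<phi> Q" using le step.prems(2)[of Q P] PQ by auto
    fix Z assume Z: "Z \<in> L'" "\<phi> P \<subseteq> Z" "Z \<subseteq> \<phi> Q"
    have "\<phi> N \<subseteq> \<phi> P" using step.prems(2)[of N P] PQ by auto
    then obtain X where X: "X \<in> L" "N \<subseteq> X" "X \<subseteq> Q" "\<phi> X = Z"
      using step.prems(3)[of Z] Z by blast
    then have "P \<subseteq> X" using step.prems(2)[of P X] PQ Z by auto
    then show "Z = \<phi> P \<or> Z = \<phi> Q" using cov X by blast
  qed
  ultimately show ?case by (rule has_length.step)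
qed

section \<open>The lattice of submodules: uniqueness and additivity of length\<close>

context Module.module
begin

abbreviation submodules :: "'c set set" where
  "submodules \<equiv> {N. submodule N R M}"

lemma submodule_Int:
  assumes "submodule N R M" "submodule P R M"
  shows "submodule (N \<inter> P) R M"
proof -
  interpret N: submodule N R M by fact
  interpret P: submodule P R M by fact
  show ?thesis
    using N.subset submoduleE(3)[OF assms(1)] submoduleE(3)[OF assms(2)]
      submoduleE(5)[OF assms(1)] submoduleE(5)[OF assms(2)] N.one_closed P.one_closed
    by (intro submoduleI) auto
qed

lemma submodule_zero: "submodule N R M \<Longrightarrow> \<zero>\<^bsub>M\<^esub> \<in> N"
  using subgroup.one_closed[OF submodule.axioms(1)] by fastforce

lemma submodule_minus:
  assumes "submodule N R M" "x \<in> N" "y \<in> N"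
  shows "x \<ominus>\<^bsub>M\<^esub> y \<in> N"
  using submoduleE(3,5)[OF assms(1)] assms(2,3) by (simp add: a_minus_def)

lemma mem_set_add: "x \<in> N <+>\<^bsub>M\<^esub> P \<longleftrightarrow> (\<exists>n\<in>N. \<exists>p\<in>P. x = n \<oplus>\<^bsub>M\<^esub> p)"
  by (auto simp: set_add_def')

lemma submodule_set_add:
  assumes N: "submodule N R M" and P: "submodule P R M"
  shows "submodule (N <+>\<^bsub>M\<^esub> P) R M"
proof (rule submoduleI)
  note s = submoduleE(1)[OF N, THEN subsetD] submoduleE(1)[OF P, THEN subsetD]
  show "N <+>\<^bsub>M\<^esub> P \<subseteq> carrier M" using s by (auto simp: mem_set_add)
  show "\<zero>\<^bsub>M\<^esub> \<in> N <+>\<^bsub>M\<^esub> P"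
    unfolding mem_set_add using submodule_zero[OF N] submodule_zero[OF P] by force
  show "\<ominus>\<^bsub>M\<^esub> x \<in> N <+>\<^bsub>M\<^esub> P" if "x \<in> N <+>\<^bsub>M\<^esub> P" for x
    using that unfolding mem_set_add
    by (metis M.minus_add s submoduleE(3)[OF N] submoduleE(3)[OF P])
  show "x \<oplus>\<^bsub>M\<^esub> y \<in> N <+>\<^bsub>M\<^esub> P" if xy: "x \<in> N <+>\<^bsub>M\<^esub> P" "y \<in> N <+>\<^bsub>M\<^esub> P" for x y
  proof -
    obtain n p n' p' where np: "n \<in> N" "p \<in> P" "n' \<in> N" "p' \<in> P"
      "x = n \<oplus>\<^bsub>M\<^esub> p" "y = n' \<oplus>\<^bsub>M\<^esub> p'" using xy by (auto simp: mem_set_add)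
    then have "x \<oplus>\<^bsub>M\<^esub> y = (n \<oplus>\<^bsub>M\<^esub> n') \<oplus>\<^bsub>M\<^esub> (p \<oplus>\<^bsub>M\<^esub> p')"
      using s by (simp add: M.a_ac)
    then show ?thesis
      unfolding mem_set_add using np submoduleE(5)[OF N] submoduleE(5)[OF P] by blast
  qed
  show "a \<odot>\<^bsub>M\<^esub> x \<in> N <+>\<^bsub>M\<^esub> P" if "a \<in> carrier R" "x \<in> N <+>\<^bsub>M\<^esub> P" for a x
    using that unfolding mem_set_add
    by (metis smult_r_distr s submoduleE(4)[OF N] submoduleE(4)[OF P])
qed

lemma subset_set_add:
  assumes "submodule N R M" "submodule P R M"
  shows "N \<subseteq> N <+>\<^bsub>M\<^esub> P" "P \<subseteq> N <+>\<^bsub>M\<^esub> P"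
proof -
  show "N \<subseteq> N <+>\<^bsub>M\<^esub> P"
  proof
    fix x assume "x \<in> N"
    then show "x \<in> N <+>\<^bsub>M\<^esub> P"
      unfolding mem_set_add using submodule_zero[OF assms(2)] submoduleE(1)[OF assms(1)]
      by (intro bexI[of _ x] bexI[of _ "\<zero>\<^bsub>M\<^esub>"]) auto
  qed
  show "P \<subseteq> N <+>\<^bsub>M\<^esub> P"
  proof
    fix x assume "x \<in> P"
    then show "x \<in> N <+>\<^bsub>M\<^esub> P"
      unfolding mem_set_add using submodule_zero[OF assms(1)] submoduleE(1)[OF assms(2)]
      by (intro bexI[of _ x] bexI[of _ "\<zero>\<^bsub>M\<^esub>"]) auto
  qed
qed

lemma set_add_subset:
  assumes "submodule Q R M" "N \<subseteq> Q" "P \<subseteq> Q"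
  shows "N <+>\<^bsub>M\<^esub> P \<subseteq> Q"
  using assms(2,3) submoduleE(5)[OF assms(1)] by (force simp: mem_set_add)

text \<open>The rank of \<open>X\<close> counts the factors of the series in which \<open>X\<close> has a nonzero
  image; it replaces the Jordan--Hoelder exchange argument.\<close>

lemma has_length_rank:
  assumes "has_length submodules N P n"
  shows "\<exists>h. rank_on submodules N P h \<and> (\<forall>X\<in>submodules. N \<subseteq> X \<longrightarrow> X \<subseteq> P \<longrightarrow> h X \<le> n)"
  using assms
proof induction
  case (base N)
  then show ?case by (intro exI[of _ "\<lambda>_. 0"]) (auto simp: rank_on_def)
next
  case (step N P n Q)
  from step.IH obtain h where rank: "rank_on submodules N P h"
    and bound: "\<And>X. submodule X R M \<Longrightarrow> N \<subseteq> X \<Longrightarrow> X \<subseteq> P \<Longrightarrow> h X \<le> n"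
    by auto
  have P: "submodule P R M" "N \<subseteq> P" and Q: "submodule Q R M" "P \<subseteq> Q"
    and cov: "\<And>Y. submodule Y R M \<Longrightarrow> P \<subseteq> Y \<Longrightarrow> Y \<subseteq> Q \<Longrightarrow> Y = P \<or> Y = Q"
    using step.hyps has_length_mem(3)[OF step.hyps(1)] by (auto simp: covers_def)
  \<comment> \<open>The old rank measures the part inside \<open>P\<close>; the extra unit records a
    nonzero image in the new factor \<open>Q / P\<close>.\<close>
  let ?h = "\<lambda>X. h (X \<inter> P) + (if X \<subseteq> P then 0 else 1)"
  have "?h X < ?h Y"
    if X: "submodule X R M" "N \<subseteq> X" and Y: "submodule Y R M" "Y \<subseteq> Q" and XY: "X \<subset> Y" for X Y
  proof (cases "X \<inter> P = Y \<inter> P")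
    case False
    then have "h (X \<inter> P) < h (Y \<inter> P)"
      using X Y XY P by (intro rank_onD[OF rank]) (auto intro: submodule_Int)
    then show ?thesis using XY by auto
  next
    case True
    then have nY: "\<not> Y \<subseteq> P" using XY by auto
    \<comment> \<open>Modularity: if \<open>X\<close> were not inside \<open>P\<close>, then
      \<open>X + P = Q\<close> by the cover, and equality of the intersections with \<open>P\<close>
      would force \<open>Y \<subseteq> X\<close>.\<close>
    have "X \<subseteq> P"
    proof (rule ccontr)
      assume nX: "\<not> X \<subseteq> P"
      have "X <+>\<^bsub>M\<^esub> P = Q"
        using cov[OF submodule_set_add[OF X(1) P(1)]] subset_set_add[OF X(1) P(1)]
          set_add_subset[OF Q(1), of X P] X Y XY Q nX by blast
      have "y \<in> X" if y: "y \<in> Y" for y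
      proof -
        obtain x c where xc: "x \<in> X" "c \<in> P" "y = x \<oplus>\<^bsub>M\<^esub> c"
          using y Y \<open>X <+>\<^bsub>M\<^esub> P = Q\<close> unfolding mem_set_add[symmetric] by (metis mem_set_add subsetD)
        have car: "x \<in> carrier M" "c \<in> carrier M"
          using xc submoduleE(1)[OF X(1)] submoduleE(1)[OF P(1)] by auto
        have "c = y \<ominus>\<^bsub>M\<^esub> x"
          using xc car by (simp add: M.minus_eq M.a_ac M.r_neg)
        also have "\<dots> \<in> Y" using submodule_minus[OF Y(1) y] xc XY by blast
        finally have "c \<in> X" using True xc by blast
        then show ?thesis using xc submoduleE(5)[OF X(1)] by blast
      qed
      then show False using XY by blast
    qed
    then show ?thesis using True nY by auto
  qed
  moreover have "?h X \<le> Suc n" if "submodule X R M" "N \<subseteq> X" for X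
    using bound[OF submodule_Int[OF that(1) P(1)]] that P by auto
  ultimately show ?case by (intro exI[of _ ?h]) (simp add: rank_on_def)
qed

text \<open>The rank built from one chain is bounded by the length of that chain and increases
  strictly along the other; exchanging the two chains gives both inequalities.\<close>

lemma has_length_unique:
  assumes "has_length submodules N P n" "has_length submodules N P m"
  shows "n = m"
proof -
  have "k \<le> l" if k: "has_length submodules N P k" and l: "has_length submodules N P l" for k l
  proof -
    obtain h where h: "rank_on submodules N P h"
      "\<forall>X\<in>submodules. N \<subseteq> X \<longrightarrow> X \<subseteq> P \<longrightarrow> h X \<le> l"
      using has_length_rank[OF l] by blast
    have "h N + k \<le> h P" using k h(1) by (rule has_length_le_rank)
    moreover have "h P \<le> l" using h(2) has_length_mem[OF k] by blast
    ultimately show ?thesis by simp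
  qed
  then show ?thesis using assms by (meson le_antisym)
qed

text \<open>The rank of the big interval restricts to \<open>L\<close> and to the smaller interval.
  Applied to graded submodules, this yields a graded saturated chain from an ungraded one.\<close>

lemma has_length_exists_subfamily:
  assumes "has_length submodules N Q n" "L \<subseteq> submodules" "X \<in> L" "Y \<in> L" "N \<subseteq> X" "X \<subseteq> Y" "Y \<subseteq> Q"
  shows "\<exists>m. has_length L X Y m"
proof -
  obtain h where h: "rank_on submodules N Q h"
    using has_length_rank[OF assms(1)] by blast
  show ?thesis
    using assms(3,4,6) rank_on_mono[OF h assms(2,5,7)] by (rule has_length_exists)
qed

text \<open>Additivity of length: both pieces have a length, and the sum is the given one by
  uniqueness.\<close>

lemma has_length_split:
  assumes "has_length submodules N Q n" "submodule P R M" "N \<subseteq> P" "P \<subseteq> Q"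
  shows "\<exists>k l. has_length submodules N P k \<and> has_length submodules P Q l \<and> n = k + l"
proof -
  note mem = has_length_mem[OF assms(1)]
  obtain k where k: "has_length submodules N P k"
    using has_length_exists_subfamily[OF assms(1), of submodules N P] mem assms by auto
  obtain l where l: "has_length submodules P Q l"
    using has_length_exists_subfamily[OF assms(1), of submodules P Q] mem assms by auto
  show ?thesis
    using has_length_unique[OF assms(1) has_length_trans[OF k l]] k l by blast
qed

end

subsection \<open>Spans and colon submodules\<close>

text \<open>Sums are formed one generator at a time, so inductions treat a single generator per
  step. The generating sets used below are stable under negation, so their spans are
  subgroups.\<close>

inductive_set additive_span :: "('a, 'm) ring_scheme \<Rightarrow> 'a set \<Rightarrow> 'a set" for M and G where
  zero: "\<zero>\<^bsub>M\<^esub> \<in> additive_span M G"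
| add: "\<lbrakk>g \<in> G; x \<in> additive_span M G\<rbrakk> \<Longrightarrow> g \<oplus>\<^bsub>M\<^esub> x \<in> additive_span M G"

lemma additive_span_least:
  assumes "\<zero>\<^bsub>M\<^esub> \<in> H" "G \<subseteq> H" "\<And>x y. x \<in> H \<Longrightarrow> y \<in> H \<Longrightarrow> x \<oplus>\<^bsub>M\<^esub> y \<in> H"
  shows "additive_span M G \<subseteq> H"
proof
  show "x \<in> H" if "x \<in> additive_span M G" for x
    using that by induction (use assms in auto)
qed

lemma additive_span_mono:
  assumes "G \<subseteq> G'"
  shows "additive_span M G \<subseteq> additive_span M G'"
proof
  show "x \<in> additive_span M G'" if "x \<in> additive_span M G" for x
    using that by induction (use assms in \<open>auto intro: additive_span.intros\<close>)
qed

context abelian_monoid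
begin

lemma additive_span_closed:
  assumes "G' \<subseteq> carrier G" "x \<in> additive_span G G'"
  shows "x \<in> carrier G"
  using additive_span_least[of G "carrier G" G'] assms by auto

lemma additive_span_superset:
  assumes "G' \<subseteq> carrier G"
  shows "G' \<subseteq> additive_span G G'"
proof
  fix g assume "g \<in> G'"
  then show "g \<in> additive_span G G'"
    using additive_span.add[OF _ additive_span.zero, of g G' G] assms by auto
qed

lemma additive_span_add:
  assumes "G' \<subseteq> carrier G" "x \<in> additive_span G G'" "y \<in> additive_span G G'"
  shows "x \<oplus> y \<in> additive_span G G'"
  using assms(2)
proof induction
  case zero
  then show ?case using assms additive_span_closed by simp
next
  case (add g x)
  have "g \<oplus> x \<oplus> y = g \<oplus> (x \<oplus> y)"
    using add assms additive_span_closed by (intro a_assoc) auto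
  with add show ?case by (auto intro: additive_span.add)
qed

end

context Module.module
begin

lemma additive_span_submodule_least:
  assumes "submodule N R M" "G \<subseteq> N"
  shows "additive_span M G \<subseteq> N"
  using assms submodule_zero submoduleE(5)[OF assms(1)] by (intro additive_span_least) auto

lemma smult_additive_span:
  assumes "submodule N R M" "a \<in> carrier R" "G \<subseteq> carrier M" "\<And>g. g \<in> G \<Longrightarrow> a \<odot>\<^bsub>M\<^esub> g \<in> N"
    and "x \<in> additive_span M G"
  shows "a \<odot>\<^bsub>M\<^esub> x \<in> N"
  using assms(5)
proof induction
  case zero
  then show ?case using assms submodule_zero by simp
next
  case (add g x)
  have "a \<odot>\<^bsub>M\<^esub> (g \<oplus>\<^bsub>M\<^esub> x) = a \<odot>\<^bsub>M\<^esub> g \<oplus>\<^bsub>M\<^esub> a \<odot>\<^bsub>M\<^esub> x"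
    using assms(2,3) add M.additive_span_closed by (intro smult_r_distr) auto
  then show ?case using add assms(4) submoduleE(5)[OF assms(1)] by simp
qed

lemma submodule_additive_span:
  assumes "G \<subseteq> carrier M" "\<And>a g. a \<in> carrier R \<Longrightarrow> g \<in> G \<Longrightarrow> a \<odot>\<^bsub>M\<^esub> g \<in> G"
  shows "submodule (additive_span M G) R M"
proof (rule submoduleI)
  have smult: "a \<odot>\<^bsub>M\<^esub> x \<in> additive_span M G" if "a \<in> carrier R" "x \<in> additive_span M G" for a x
    using that(2)
  proof induction
    case (add g x)
    have "a \<odot>\<^bsub>M\<^esub> (g \<oplus>\<^bsub>M\<^esub> x) = a \<odot>\<^bsub>M\<^esub> g \<oplus>\<^bsub>M\<^esub> a \<odot>\<^bsub>M\<^esub> x"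
      using assms(1) add that M.additive_span_closed by (intro smult_r_distr) auto
    then show ?case using add assms(2) that by (auto intro: additive_span.add)
  qed (use that in \<open>auto intro: additive_span.zero\<close>)
  then show "\<And>a x. a \<in> carrier R \<Longrightarrow> x \<in> additive_span M G \<Longrightarrow> a \<odot>\<^bsub>M\<^esub> x \<in> additive_span M G" .
  show "\<ominus>\<^bsub>M\<^esub> x \<in> additive_span M G" if "x \<in> additive_span M G" for x
    using smult[of "\<ominus> \<one>" x] that M.additive_span_closed[OF assms(1)] by (simp add: smult_l_minus)
qed (use assms(1) M.additive_span_closed M.additive_span_add in \<open>auto intro: additive_span.zero\<close>)

lemma ideal_smult_least:
  assumes "submodule N R M" "\<And>a x. a \<in> I \<Longrightarrow> x \<in> carrier M \<Longrightarrow> a \<odot>\<^bsub>M\<^esub> x \<in> N"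
  shows "ideal_smult M I \<subseteq> N"
proof
  show "x \<in> N" if "x \<in> ideal_smult M I" for x
    using that by induction (use assms(2) submoduleE(5)[OF assms(1)] in auto)
qed

text \<open>The colon submodule \<open>(N : b)\<close>; it is stable under scalars because the ring
  is commutative.\<close>

lemma submodule_smult_preimage:
  assumes "submodule N R M" "b \<in> carrier R"
  shows "submodule {m \<in> carrier M. b \<odot>\<^bsub>M\<^esub> m \<in> N} R M"
proof (rule submoduleI)
  show "a \<odot>\<^bsub>M\<^esub> x \<in> {m \<in> carrier M. b \<odot>\<^bsub>M\<^esub> m \<in> N}"
    if "a \<in> carrier R" "x \<in> {m \<in> carrier M. b \<odot>\<^bsub>M\<^esub> m \<in> N}" for a x
  proof -
    have "b \<odot>\<^bsub>M\<^esub> (a \<odot>\<^bsub>M\<^esub> x) = a \<odot>\<^bsub>M\<^esub> (b \<odot>\<^bsub>M\<^esub> x)"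
      using that assms by (simp add: smult_assoc1[symmetric] R.m_comm)
    then show ?thesis using that submoduleE(4)[OF assms(1)] by simp
  qed
qed (use assms submodule_zero submoduleE(3,5)[OF assms(1)] in
    \<open>auto simp: smult_r_distr smult_r_minus\<close>)

lemma submodule_smult_image:
  assumes "submodule N R M" "b \<in> carrier R"
  shows "submodule ((\<lambda>m. b \<odot>\<^bsub>M\<^esub> m) ` N) R M"
proof (rule submoduleI)
  note N = submoduleE(1)[OF assms(1), THEN subsetD]
  show "(\<lambda>m. b \<odot>\<^bsub>M\<^esub> m) ` N \<subseteq> carrier M" using N assms by auto
  show "\<zero>\<^bsub>M\<^esub> \<in> (\<lambda>m. b \<odot>\<^bsub>M\<^esub> m) ` N"
    using submodule_zero[OF assms(1)] assms by (intro image_eqI[of _ _ "\<zero>\<^bsub>M\<^esub>"]) auto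
  show "\<ominus>\<^bsub>M\<^esub> x \<in> (\<lambda>m. b \<odot>\<^bsub>M\<^esub> m) ` N" if x: "x \<in> (\<lambda>m. b \<odot>\<^bsub>M\<^esub> m) ` N" for x
  proof -
    obtain y where "y \<in> N" "x = b \<odot>\<^bsub>M\<^esub> y" using x by auto
    then show ?thesis
      using N assms(2) submoduleE(3)[OF assms(1)]
      by (intro image_eqI[of _ _ "\<ominus>\<^bsub>M\<^esub> y"]) (auto simp: smult_r_minus)
  qed
  show "x \<oplus>\<^bsub>M\<^esub> y \<in> (\<lambda>m. b \<odot>\<^bsub>M\<^esub> m) ` N"
    if xy: "x \<in> (\<lambda>m. b \<odot>\<^bsub>M\<^esub> m) ` N" "y \<in> (\<lambda>m. b \<odot>\<^bsub>M\<^esub> m) ` N" for x y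
  proof -
    obtain x' y' where "x' \<in> N" "y' \<in> N" "x = b \<odot>\<^bsub>M\<^esub> x'" "y = b \<odot>\<^bsub>M\<^esub> y'" using xy by auto
    then show ?thesis
      using N assms(2) submoduleE(5)[OF assms(1)]
      by (intro image_eqI[of _ _ "x' \<oplus>\<^bsub>M\<^esub> y'"]) (auto simp: smult_r_distr)
  qed
  show "a \<odot>\<^bsub>M\<^esub> x \<in> (\<lambda>m. b \<odot>\<^bsub>M\<^esub> m) ` N"
    if a: "a \<in> carrier R" and x: "x \<in> (\<lambda>m. b \<odot>\<^bsub>M\<^esub> m) ` N" for a x
  proof -
    obtain y where y: "y \<in> N" "x = b \<odot>\<^bsub>M\<^esub> y" using x by auto
    have "a \<odot>\<^bsub>M\<^esub> x = b \<odot>\<^bsub>M\<^esub> (a \<odot>\<^bsub>M\<^esub> y)"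
      using y a assms(2) N by (simp add: smult_assoc1[symmetric] R.m_comm)
    then show ?thesis using y a submoduleE(4)[OF assms(1)] by auto
  qed
qed

text \<open>Multiplication by \<open>b\<close> induces an isomorphism from \<open>M / (N : b)\<close> onto
  \<open>(N + b M) / N\<close>.\<close>

lemma has_length_smult:
  assumes N: "submodule N R M" and b: "b \<in> carrier R"
    and len: "has_length submodules {m \<in> carrier M. b \<odot>\<^bsub>M\<^esub> m \<in> N} (carrier M) k"
  shows "has_length submodules N (N <+>\<^bsub>M\<^esub> (\<lambda>m. b \<odot>\<^bsub>M\<^esub> m) ` carrier M) k"
proof -
  let ?J = "{m \<in> carrier M. b \<odot>\<^bsub>M\<^esub> m \<in> N}" and ?b = "\<lambda>X. (\<lambda>m. b \<odot>\<^bsub>M\<^esub> m) ` X"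
  let ?f = "\<lambda>X. N <+>\<^bsub>M\<^esub> ?b X"
  have fX: "submodule (?f X) R M" "N \<subseteq> ?f X" "?b X \<subseteq> ?f X" if "submodule X R M" for X
    using N submodule_smult_image[OF that b] submodule_set_add subset_set_add by auto
  have J: "submodule ?J R M" by (rule submodule_smult_preimage[OF N b])
  have fJ: "?f ?J = N"
    using set_add_subset[OF N, of N "?b ?J"] fX(2)[OF J] by auto
  have "has_length submodules (?f ?J) (?f (carrier M)) k"
  proof (rule has_length_order_iso[OF len])
    fix X Y assume X: "X \<in> submodules" "?J \<subseteq> X" and Y: "Y \<in> submodules" "?J \<subseteq> Y"
    show "?f X \<subseteq> ?f Y \<longleftrightarrow> X \<subseteq> Y"
    proof
      assume "X \<subseteq> Y"
      then show "?f X \<subseteq> ?f Y"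
        using fX[of Y] Y by (intro set_add_subset) auto
    next
      assume sub: "?f X \<subseteq> ?f Y"
      show "X \<subseteq> Y"
      proof
        fix x assume x: "x \<in> X"
        then have "b \<odot>\<^bsub>M\<^esub> x \<in> ?f Y" using fX(3)[of X] X sub by blast
        then obtain n y where ny: "n \<in> N" "y \<in> Y" "b \<odot>\<^bsub>M\<^esub> x = n \<oplus>\<^bsub>M\<^esub> b \<odot>\<^bsub>M\<^esub> y"
          by (auto simp: mem_set_add)
        have car: "x \<in> carrier M" "y \<in> carrier M" "n \<in> carrier M"
          using x ny X Y N submoduleE(1) by auto
        \<comment> \<open>The difference \<open>x - y\<close> is carried into \<open>N\<close>, so
          it lies in \<open>?J\<close> and hence in \<open>Y\<close>.\<close>
        have "b \<odot>\<^bsub>M\<^esub> (x \<ominus>\<^bsub>M\<^esub> y) = b \<odot>\<^bsub>M\<^esub> x \<ominus>\<^bsub>M\<^esub> b \<odot>\<^bsub>M\<^esub> y"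
          using car b by (simp add: M.minus_eq smult_r_distr smult_r_minus)
        also have "\<dots> = n"
          using car b ny(3) by (simp add: M.minus_eq M.a_assoc M.r_neg)
        finally have "x \<ominus>\<^bsub>M\<^esub> y \<in> Y" using Y car ny by auto
        then have "x \<ominus>\<^bsub>M\<^esub> y \<oplus>\<^bsub>M\<^esub> y \<in> Y" using Y ny submoduleE(5) by blast
        then show "x \<in> Y" using car by (simp add: M.minus_eq M.a_assoc M.l_neg)
      qed
    qed
  next
    fix Z assume Z: "Z \<in> submodules" "?f ?J \<subseteq> Z" "Z \<subseteq> ?f (carrier M)"
    \<comment> \<open>The inverse of \<open>?f\<close> sends \<open>Z\<close> to the colon submodule
      \<open>(Z : b)\<close>.\<close>
    let ?X = "{m \<in> carrier M. b \<odot>\<^bsub>M\<^esub> m \<in> Z}"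
    have X: "submodule ?X R M" using Z submodule_smult_preimage b by auto
    have NZ: "N \<subseteq> Z" using Z fJ by simp
    have "Z \<subseteq> ?f ?X"
    proof
      fix z assume z: "z \<in> Z"
      then obtain n m where nm: "n \<in> N" "m \<in> carrier M" "z = n \<oplus>\<^bsub>M\<^esub> b \<odot>\<^bsub>M\<^esub> m"
        using Z(3) unfolding subset_iff mem_set_add by blast
      have "b \<odot>\<^bsub>M\<^esub> m = z \<ominus>\<^bsub>M\<^esub> n"
        using nm b subsetD[OF submoduleE(1)[OF N] nm(1)] by (simp add: M.minus_eq M.a_ac M.r_neg2)
      also have "\<dots> \<in> Z" using Z(1) NZ nm z submodule_minus by blast
      finally have "m \<in> ?X" using nm by simp
      then show "z \<in> ?f ?X" unfolding mem_set_add using nm by blast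
    qed
    moreover have "?f ?X \<subseteq> Z" using Z(1) NZ by (intro set_add_subset) auto
    ultimately have "?f ?X = Z" by simp
    moreover have "?J \<subseteq> ?X" using NZ by auto
    ultimately show "\<exists>X\<in>submodules. ?J \<subseteq> X \<and> X \<subseteq> carrier M \<and> ?f X = Z"
      using X by (intro bexI[of _ ?X]) auto
  qed (use fX in auto)
  then show ?thesis by (simp add: fJ)
qed

end

subsection \<open>Hilbert--Samuel functions\<close>

text \<open>Surplus entries of the longer list are dropped, so closure in the ring holds for lists
  of any lengths.\<close>

fun monomial :: "('a, 'm) ring_scheme \<Rightarrow> 'a list \<Rightarrow> nat list \<Rightarrow> 'a" where
  "monomial R (a # as) (k # u) = a [^]\<^bsub>R\<^esub> k \<otimes>\<^bsub>R\<^esub> monomial R as u"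
| "monomial R _ _ = \<one>\<^bsub>R\<^esub>"

lemma exponents_add:
  assumes "u \<in> exponents r n" "v \<in> exponents r m"
  shows "map2 (+) u v \<in> exponents r (n + m)"
proof -
  have "length u = length v \<Longrightarrow> sum_list (map2 (+) u v) = sum_list u + sum_list v"
    by (induction u v rule: list_induct2) auto
  then show ?thesis using assms by (auto simp: exponents_def)
qed

text \<open>The lexicographic order is a monomial order: it is preserved by multiplication with a
  monomial. This is what makes the colon submodules grow.\<close>

lemma map2_add_less:
  fixes u v w :: "nat list"
  assumes "length u = length v" "length v = length w" "u < v"
  shows "map2 (+) u w < map2 (+) v w"
  using assms by (induction u v w rule: list_induct3) auto

text \<open>The componentwise order is divisibility of monomials, and \<open>w\<close> is the
  exponent of the cofactor.\<close>

lemma list_all2_le_map2_add: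
  fixes u v :: "nat list"
  assumes "list_all2 (\<le>) u v"
  obtains w where "length w = length u" "v = map2 (+) u w"
proof -
  have "\<exists>w. length w = length u \<and> v = map2 (+) u w"
    using assms
  proof induction
    case (Cons x xs y ys)
    then obtain w where "length w = length xs" "ys = map2 (+) xs w" by auto
    then show ?case using Cons by (intro exI[of _ "(y - x) # w"]) auto
  qed simp
  then show ?thesis using that by blast
qed

context cring
begin

lemma monomial_closed: "set as \<subseteq> carrier R \<Longrightarrow> monomial R as u \<in> carrier R"
  by (induction as arbitrary: u; case_tac u) auto

lemma monomial_add:
  assumes "set as \<subseteq> carrier R" "length u = length as" "length v = length as"
  shows "monomial R as (map2 (+) u v) = monomial R as u \<otimes> monomial R as v"
  using assms(2)[symmetric] assms(3) assms(1)
proof (induction as u arbitrary: v rule: list_induct2)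
  case (Cons a as k u)
  then obtain l w where v: "v = l # w" "length w = length as" by (cases v) auto
  then have "monomial R as (map2 (+) u w) = monomial R as u \<otimes> monomial R as w"
    using Cons by auto
  then show ?case
    using Cons.prems v monomial_closed[of as] by (simp add: nat_pow_mult[symmetric] m_ac)
qed simp

lemma monomial_zero:
  "monomial R as (replicate (length as) 0) = \<one>"
  by (induction as) auto

lemma monomial_generator:
  assumes "set as \<subseteq> carrier R" "a \<in> set as"
  shows "\<exists>e\<in>exponents (length as) 1. monomial R as e = a"
  using assms
proof (induction as)
  case (Cons b as)
  show ?case
  proof (cases "a = b")
    case True
    then show ?thesis using Cons.prems
      by (intro bexI[of _ "1 # replicate (length as) 0"])
        (auto simp: exponents_def monomial_zero sum_list_replicate)
  next
    case False
    then obtain e where "e \<in> exponents (length as) 1" "monomial R as e = a"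
      using Cons by auto
    then show ?thesis using Cons.prems
      by (intro bexI[of _ "0 # e"]) (auto simp: exponents_def)
  qed
qed simp

lemma ideal_ideal_power:
  assumes "ideal I R"
  shows "ideal (ideal_power R I n) R"
proof -
  interpret S: comm_monoid "ideals_set R" by (rule ideals_set_is_comm_monoid)
  show ?thesis using S.nat_pow_closed[of I n] assms by (simp add: ideals_set_def)
qed

lemma ideal_power_0: "ideal_power R I 0 = carrier R"
  by (simp add: ideals_set_def nat_pow_def)

lemma ideal_power_Suc: "ideal_power R I (Suc n) = ideal_power R I n \<cdot> I"
  by (simp add: ideals_set_def nat_pow_def)

lemma ideal_power_mult:
  assumes "ideal I R" "x \<in> ideal_power R I n" "y \<in> ideal_power R I m"
  shows "x \<otimes> y \<in> ideal_power R I (n + m)"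
proof -
  interpret S: comm_monoid "ideals_set R" by (rule ideals_set_is_comm_monoid)
  have "ideal_power R I (n + m) = ideal_power R I n \<cdot> ideal_power R I m"
    using S.nat_pow_mult[of I n m] assms(1) by (simp add: ideals_set_def)
  then show ?thesis using assms by (simp add: ideal_prod.prod)
qed

lemma monomial_in_ideal_power:
  assumes "ideal I R" "set as \<subseteq> I" "length u = length as"
  shows "monomial R as u \<in> ideal_power R I (sum_list u)"
  using assms(3)[symmetric] assms(2)
proof (induction as u rule: list_induct2)
  case (Cons a as k u)
  have a: "a \<in> I" "a \<in> carrier R" using Cons.prems ideal.Icarr[OF assms(1)] by auto
  have "a [^] k \<in> ideal_power R I k" for k :: nat
  proof (induction k)
    case (Suc k)
    then show ?case using a unfolding ideal_power_Suc by (auto intro: ideal_prod.prod)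
  qed (simp add: ideals_set_def)
  then show ?case
    using Cons ideal_power_mult[OF assms(1)] by auto
qed (simp add: ideals_set_def)

end

section \<open>The submodules \<open>I^n M\<close> as spans of monomial multiples\<close>

context Module.module
begin

definition monomial_multiples :: "'a list \<Rightarrow> nat list set \<Rightarrow> 'c set" where
  "monomial_multiples as V = {monomial R as v \<odot>\<^bsub>M\<^esub> m | v m. v \<in> V \<and> m \<in> carrier M}"

text \<open>A description of \<open>I^n M\<close> for \<open>I\<close> generated by
  \<open>as\<close>, justified in \<open>ideal_smult_power\<close>.\<close>

definition power_span :: "'a list \<Rightarrow> nat \<Rightarrow> 'c set" where
  "power_span as n = additive_span M (monomial_multiples as (exponents (length as) n))"

lemma monomial_multiples_closed:
  assumes "set as \<subseteq> carrier R"
  shows "monomial_multiples as V \<subseteq> carrier M"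
  using R.monomial_closed[OF assms] by (auto simp: monomial_multiples_def)

lemma smult_monomial_multiples:
  assumes "set as \<subseteq> carrier R" "a \<in> carrier R" "g \<in> monomial_multiples as V"
  shows "a \<odot>\<^bsub>M\<^esub> g \<in> monomial_multiples as V"
proof -
  obtain v m where vm: "v \<in> V" "m \<in> carrier M" "g = monomial R as v \<odot>\<^bsub>M\<^esub> m"
    using assms by (auto simp: monomial_multiples_def)
  then have "a \<odot>\<^bsub>M\<^esub> g = monomial R as v \<odot>\<^bsub>M\<^esub> (a \<odot>\<^bsub>M\<^esub> m)"
    using assms R.monomial_closed by (simp add: smult_assoc1[symmetric] R.m_comm)
  then show ?thesis using vm assms unfolding monomial_multiples_def by blast
qed

lemma submodule_power_span:
  assumes "set as \<subseteq> carrier R"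
  shows "submodule (power_span as n) R M"
  unfolding power_span_def
  using monomial_multiples_closed[OF assms] smult_monomial_multiples[OF assms]
  by (intro submodule_additive_span) auto

lemma monomial_smult_monomial_multiples:
  assumes "set as \<subseteq> carrier R" "length w = length as" "\<And>v. v \<in> V \<Longrightarrow> length v = length as"
    and "\<And>v. v \<in> V \<Longrightarrow> map2 (+) v w \<in> V'" and "g \<in> monomial_multiples as V"
  shows "monomial R as w \<odot>\<^bsub>M\<^esub> g \<in> monomial_multiples as V'"
proof -
  obtain v m where vm: "v \<in> V" "m \<in> carrier M" "g = monomial R as v \<odot>\<^bsub>M\<^esub> m"
    using assms by (auto simp: monomial_multiples_def)
  then have "monomial R as w \<odot>\<^bsub>M\<^esub> g = monomial R as (map2 (+) v w) \<odot>\<^bsub>M\<^esub> m"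
    using assms(1-3) R.monomial_closed
    by (simp add: smult_assoc1[symmetric] R.m_comm R.monomial_add)
  then show ?thesis using vm assms(4) unfolding monomial_multiples_def by blast
qed

lemma monomial_smult_power_span:
  assumes as: "set as \<subseteq> carrier R" and w: "w \<in> exponents (length as) k" and x: "x \<in> power_span as n"
  shows "monomial R as w \<odot>\<^bsub>M\<^esub> x \<in> power_span as (n + k)"
proof (rule smult_additive_span[OF submodule_power_span[OF as] _ _ _ x[unfolded power_span_def]])
  fix g assume "g \<in> monomial_multiples as (exponents (length as) n)"
  then have "monomial R as w \<odot>\<^bsub>M\<^esub> g \<in> monomial_multiples as (exponents (length as) (n + k))"
    by (rule monomial_smult_monomial_multiples[OF as, rotated -1])
      (use w in \<open>auto intro: exponents_add, auto simp: exponents_def\<close>)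
  then show "monomial R as w \<odot>\<^bsub>M\<^esub> g \<in> power_span as (n + k)"
    unfolding power_span_def using M.additive_span_superset[OF monomial_multiples_closed[OF as]] by blast
qed (use as R.monomial_closed monomial_multiples_closed in auto)

text \<open>The scalars carrying one span into the next form an ideal \<open>?K\<close>. It contains
  the generators, which are the monomials of degree 1, hence the whole ideal they generate.\<close>

lemma genideal_smult_power_span:
  assumes as: "set as \<subseteq> carrier R" and a: "a \<in> Idl (set as)" and x: "x \<in> power_span as n"
  shows "a \<odot>\<^bsub>M\<^esub> x \<in> power_span as (Suc n)"
proof -
  let ?P = "power_span as (Suc n)"
  let ?K = "{a \<in> carrier R. \<forall>x\<in>power_span as n. a \<odot>\<^bsub>M\<^esub> x \<in> ?P}"
  note car = submoduleE(1)[OF submodule_power_span[OF as], THEN subsetD]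
  note P = submodule_zero[OF submodule_power_span[OF as]] submoduleE(3,4,5)[OF submodule_power_span[OF as]]
  have "ideal ?K R"
  proof (rule idealI[OF R.ring_axioms])
    show "subgroup ?K (add_monoid R)"
      by (rule R.add.subgroupI)
        (use car P in \<open>auto simp: smult_l_distr smult_l_minus a_inv_def[symmetric] intro!: exI[of _ \<zero>]\<close>)
    show "b \<otimes> a \<in> ?K" if "a \<in> ?K" "b \<in> carrier R" for a b
      using that car P by (auto simp: smult_assoc1)
    then show "a \<otimes> b \<in> ?K" if "a \<in> ?K" "b \<in> carrier R" for a b
      using that R.m_comm by auto
  qed
  moreover have "set as \<subseteq> ?K"
  proof
    fix b assume b: "b \<in> set as"
    then obtain e where e: "e \<in> exponents (length as) 1" "monomial R as e = b"
      using R.monomial_generator[OF as] by blast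
    then show "b \<in> ?K" using monomial_smult_power_span[OF as e(1), of _ n] b as by auto
  qed
  ultimately have "Idl (set as) \<subseteq> ?K" by (rule R.genideal_minimal)
  then show ?thesis using a x by blast
qed

text \<open>One inclusion is an induction on \<open>n\<close>: a product of \<open>i\<close> in
  \<open>I^n\<close> and \<open>j\<close> in \<open>I\<close> acts by \<open>i\<close> first and
  then by \<open>j\<close>, each \<open>j\<close> raising the degree of the span by one. For the
  other, monomials of degree \<open>n\<close> in elements of \<open>I\<close> lie in
  \<open>I^n\<close>.\<close>

lemma ideal_smult_power:
  assumes as: "set as \<subseteq> carrier R" and I: "I = Idl (set as)"
  shows "ideal_smult M (ideal_power R I n) = power_span as n"
proof -
  have idI: "ideal I R" unfolding I by (rule R.genideal_ideal[OF as])
  have asI: "set as \<subseteq> I" unfolding I by (rule R.genideal_self[OF as])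
  have car: "\<And>n b. b \<in> ideal_power R I n \<Longrightarrow> b \<in> carrier R"
    using ideal.Icarr[OF R.ideal_ideal_power[OF idI]] by blast
  have gen: "b \<odot>\<^bsub>M\<^esub> m \<in> power_span as n" if "b \<in> ideal_power R I n" "m \<in> carrier M" for b m n
    using that(1)
  proof (induction n arbitrary: b)
    case 0
    \<comment> \<open>The zero exponent vector: its monomial is one, so every element of
      \<open>M\<close> is a multiple of a monomial of degree 0.\<close>
    let ?z = "replicate (length as) (0::nat)"
    have "b \<odot>\<^bsub>M\<^esub> m = monomial R as ?z \<odot>\<^bsub>M\<^esub> (b \<odot>\<^bsub>M\<^esub> m)"
      using 0 car[of b 0] that(2) by (simp add: R.monomial_zero)
    moreover have "?z \<in> exponents (length as) 0" by (simp add: exponents_def sum_list_replicate)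
    ultimately have "b \<odot>\<^bsub>M\<^esub> m \<in> monomial_multiples as (exponents (length as) 0)"
      unfolding monomial_multiples_def using that(2) car[OF 0] by blast
    then show ?case
      unfolding power_span_def using M.additive_span_superset[OF monomial_multiples_closed[OF as]] by blast
  next
    case (Suc n)
    from Suc.prems show ?case unfolding R.ideal_power_Suc
    proof induction
      case (prod i j)
      have "(i \<otimes> j) \<odot>\<^bsub>M\<^esub> m = j \<odot>\<^bsub>M\<^esub> (i \<odot>\<^bsub>M\<^esub> m)"
        using prod car that(2) ideal.Icarr[OF idI] by (simp add: smult_assoc1[symmetric] R.m_comm)
      then show ?case
        using genideal_smult_power_span[OF as] prod Suc.IH I by auto
    next
      case (sum s t)
      then have "s \<in> carrier R" "t \<in> carrier R" using car[of _ "Suc n"] R.ideal_power_Suc by auto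
      then show ?case
        using sum that(2) submoduleE(5)[OF submodule_power_span[OF as]] by (simp add: smult_l_distr)
    qed
  qed
  show ?thesis
  proof
    show "ideal_smult M (ideal_power R I n) \<subseteq> power_span as n"
      by (rule ideal_smult_least[OF submodule_power_span[OF as] gen])
    have "monomial_multiples as (exponents (length as) n) \<subseteq> ideal_smult M (ideal_power R I n)"
      using R.monomial_in_ideal_power[OF idI asI]
      by (auto simp: monomial_multiples_def exponents_def intro: ideal_smult.prod)
    then show "power_span as n \<subseteq> ideal_smult M (ideal_power R I n)"
      unfolding power_span_def
      by (rule additive_span_submodule_least[OF ideal_smult_submodule[OF R.ideal_ideal_power[OF idI]]])
  qed
qed

section \<open>The lexicographic filtration of \<open>I^n M / I^(n+1) M\<close>\<close>

text \<open>As \<open>V\<close> runs through the lexicographic initial segments of the exponents of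
  degree \<open>n\<close>, these submodules climb from \<open>I^(n+1) M\<close> to
  \<open>I^n M\<close>.\<close>

definition filtration :: "'a list \<Rightarrow> nat \<Rightarrow> nat list set \<Rightarrow> 'c set" where
  "filtration as n V = additive_span M (monomial_multiples as V \<union> power_span as (Suc n))"

text \<open>The colon, by the monomial of \<open>u\<close>, of the filtration step just below
  \<open>u\<close>; the degree of that step is read off from \<open>u\<close>.\<close>

definition monomial_colon :: "'a list \<Rightarrow> nat list \<Rightarrow> 'c set" where
  "monomial_colon as u = {m \<in> carrier M. monomial R as u \<odot>\<^bsub>M\<^esub> m \<in>
     filtration as (sum_list u) {v \<in> exponents (length as) (sum_list u). v < u}}"

lemma filtration_gens_closed:
  assumes "set as \<subseteq> carrier R"
  shows "monomial_multiples as V \<union> power_span as n \<subseteq> carrier M"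
  using monomial_multiples_closed[OF assms] submoduleE(1)[OF submodule_power_span[OF assms]] by auto

lemma filtration_superset:
  assumes "set as \<subseteq> carrier R"
  shows "monomial_multiples as V \<subseteq> filtration as n V" "power_span as (Suc n) \<subseteq> filtration as n V"
  unfolding filtration_def
  using M.additive_span_superset[OF filtration_gens_closed[OF assms]] by blast+

lemma submodule_filtration:
  assumes "set as \<subseteq> carrier R"
  shows "submodule (filtration as n V) R M"
  unfolding filtration_def
  using smult_monomial_multiples[OF assms] submoduleE(4)[OF submodule_power_span[OF assms]]
  by (intro submodule_additive_span[OF filtration_gens_closed[OF assms]]) auto

lemma submodule_monomial_colon:
  assumes "set as \<subseteq> carrier R"
  shows "submodule (monomial_colon as u) R M"
  unfolding monomial_colon_def
  by (rule submodule_smult_preimage[OF submodule_filtration[OF assms] R.monomial_closed[OF assms]])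

text \<open>Puts one step of the filtration into the shape \<open>N + b M\<close> handled by
  \<open>has_length_smult\<close>.\<close>

lemma filtration_insert:
  assumes as: "set as \<subseteq> carrier R"
  shows "filtration as n (insert u V) =
    filtration as n V <+>\<^bsub>M\<^esub> (\<lambda>m. monomial R as u \<odot>\<^bsub>M\<^esub> m) ` carrier M" (is "_ = ?S")
proof
  note F = submodule_filtration[OF as]
  have B: "submodule ((\<lambda>m. monomial R as u \<odot>\<^bsub>M\<^esub> m) ` carrier M) R M"
    by (rule submodule_smult_image[OF carrier_is_submodule R.monomial_closed[OF as]])
  have S: "submodule ?S R M" by (rule submodule_set_add[OF F B])
  have "monomial_multiples as (insert u V) \<subseteq>
      monomial_multiples as V \<union> (\<lambda>m. monomial R as u \<odot>\<^bsub>M\<^esub> m) ` carrier M"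
    by (auto simp: monomial_multiples_def)
  then have "monomial_multiples as (insert u V) \<union> power_span as (Suc n) \<subseteq> ?S"
    using subset_set_add[OF F B] filtration_superset[OF as] by blast
  then show "filtration as n (insert u V) \<subseteq> ?S"
    unfolding filtration_def[of as n "insert u V"] by (rule additive_span_submodule_least[OF S])
  have "filtration as n V \<subseteq> filtration as n (insert u V)"
    unfolding filtration_def by (rule additive_span_mono) (auto simp: monomial_multiples_def)
  moreover have "(\<lambda>m. monomial R as u \<odot>\<^bsub>M\<^esub> m) ` carrier M \<subseteq> monomial_multiples as (insert u V)"
    by (auto simp: monomial_multiples_def)
  ultimately show "?S \<subseteq> filtration as n (insert u V)"
    using filtration_superset(1)[OF as, of "insert u V" n] by (intro set_add_subset[OF F]) blast+
qed

lemma filtration_empty: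
  assumes "set as \<subseteq> carrier R"
  shows "filtration as n {} = power_span as (Suc n)"
proof
  show "filtration as n {} \<subseteq> power_span as (Suc n)"
    unfolding filtration_def
    by (rule additive_span_submodule_least[OF submodule_power_span[OF assms]])
      (simp add: monomial_multiples_def)
qed (rule filtration_superset[OF assms])

text \<open>Read through \<open>ideal_smult_power\<close>, this is the inclusion of
  \<open>I^(n+1)\<close> in \<open>I^n\<close>.\<close>

lemma power_span_antimono:
  assumes as: "set as \<subseteq> carrier R"
  shows "power_span as (Suc n) \<subseteq> power_span as n"
proof -
  let ?I = "Idl (set as)"
  have I: "ideal ?I R" by (rule R.genideal_ideal[OF as])
  have "ideal_power R ?I (Suc n) \<subseteq> ideal_power R ?I n"
    unfolding R.ideal_power_Suc using R.ideal_prod_inter[OF R.ideal_ideal_power[OF I] I] by blast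
  then have "ideal_smult M (ideal_power R ?I (Suc n)) \<subseteq> ideal_smult M (ideal_power R ?I n)"
    by (intro ideal_smult_least[OF ideal_smult_submodule[OF R.ideal_ideal_power[OF I]]] ideal_smult.prod)
      blast+
  then show ?thesis unfolding ideal_smult_power[OF as refl] .
qed

lemma filtration_exponents:
  assumes "set as \<subseteq> carrier R"
  shows "filtration as n (exponents (length as) n) = power_span as n"
proof
  have "monomial_multiples as (exponents (length as) n) \<union> power_span as (Suc n) \<subseteq> power_span as n"
    using power_span_antimono[OF assms] M.additive_span_superset[OF monomial_multiples_closed[OF assms]]
    unfolding power_span_def by blast
  then show "filtration as n (exponents (length as) n) \<subseteq> power_span as n"
    unfolding filtration_def by (rule additive_span_submodule_least[OF submodule_power_span[OF assms]])
  show "power_span as n \<subseteq> filtration as n (exponents (length as) n)"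
    unfolding power_span_def
    by (rule additive_span_submodule_least[OF submodule_filtration filtration_superset(1)]) fact+
qed

text \<open>The monomial of \<open>u\<close> takes \<open>M\<close> into \<open>I^n M\<close>, and a
  further factor from the ideal leads into \<open>I^(n+1) M\<close>. So
  \<open>M / monomial_colon as u\<close> is a quotient of \<open>M / I M\<close>, which bounds its
  length uniformly in \<open>u\<close>.\<close>

lemma ideal_smult_subset_monomial_colon:
  assumes as: "set as \<subseteq> carrier R" and u: "length u = length as"
  shows "ideal_smult M (Idl (set as)) \<subseteq> monomial_colon as u"
proof (rule ideal_smult_least[OF submodule_monomial_colon[OF as]])
  show "a \<odot>\<^bsub>M\<^esub> x \<in> monomial_colon as u" if a: "a \<in> Idl (set as)" and x: "x \<in> carrier M" for a x
  proof -
    have a': "a \<in> carrier R" using ideal.Icarr[OF R.genideal_ideal[OF as] a] .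
    have "monomial R as u \<odot>\<^bsub>M\<^esub> x \<in> monomial_multiples as (exponents (length as) (sum_list u))"
      using u x by (auto simp: monomial_multiples_def exponents_def)
    then have "monomial R as u \<odot>\<^bsub>M\<^esub> x \<in> power_span as (sum_list u)"
      unfolding power_span_def using M.additive_span_superset[OF monomial_multiples_closed[OF as]] by blast
    then have "a \<odot>\<^bsub>M\<^esub> (monomial R as u \<odot>\<^bsub>M\<^esub> x) \<in> power_span as (Suc (sum_list u))"
      by (rule genideal_smult_power_span[OF as a])
    moreover have "a \<odot>\<^bsub>M\<^esub> (monomial R as u \<odot>\<^bsub>M\<^esub> x) = monomial R as u \<odot>\<^bsub>M\<^esub> (a \<odot>\<^bsub>M\<^esub> x)"
      using a' x R.monomial_closed[OF as] by (simp add: smult_assoc1[symmetric] R.m_comm)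
    ultimately show ?thesis
      unfolding monomial_colon_def using a' x filtration_superset(2)[OF as] by auto
  qed
qed

text \<open>Multiply the membership relation for \<open>u\<close> by the cofactor monomial
  \<open>w\<close> of degree \<open>k\<close>. It takes \<open>I^(n+1) M\<close> into
  \<open>I^(n+k+1) M\<close>, and exponents of degree \<open>n\<close> below \<open>u\<close> to
  exponents of degree \<open>n + k\<close> below \<open>v\<close>.\<close>

lemma monomial_colon_mono:
  assumes as: "set as \<subseteq> carrier R" and u: "length u = length as" and uv: "list_all2 (\<le>) u v"
  shows "monomial_colon as u \<subseteq> monomial_colon as v"
proof
  fix m assume "m \<in> monomial_colon as u"
  define n where "n = sum_list u"
  let ?V = "{v \<in> exponents (length as) n. v < u}"
  have m: "m \<in> carrier M" "monomial R as u \<odot>\<^bsub>M\<^esub> m \<in> filtration as n ?V"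
    using \<open>m \<in> monomial_colon as u\<close> by (auto simp: monomial_colon_def n_def)
  obtain w where w: "length w = length u" "v = map2 (+) u w"
    using list_all2_le_map2_add[OF uv] .
  define k where "k = sum_list w"
  have wk: "w \<in> exponents (length as) k" and un: "u \<in> exponents (length as) n"
    using w u by (auto simp: exponents_def k_def n_def)
  then have "v \<in> exponents (length as) (n + k)" using exponents_add w by blast
  then have vs: "sum_list v = n + k" by (simp add: exponents_def)
  let ?V' = "{v' \<in> exponents (length as) (n + k). v' < v}"
  have step: "monomial R as w \<odot>\<^bsub>M\<^esub> g \<in> filtration as (n + k) ?V'"
    if g: "g \<in> monomial_multiples as ?V \<union> power_span as (Suc n)" for g
  proof (cases "g \<in> power_span as (Suc n)")
    case True
    then show ?thesis
      using monomial_smult_power_span[OF as wk, of g "Suc n"] filtration_superset(2)[OF as] by auto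
  next
    case False
    then have "monomial R as w \<odot>\<^bsub>M\<^esub> g \<in> monomial_multiples as ?V'"
      using g un u w(1) wk map2_add_less[of _ u w]
      by (intro monomial_smult_monomial_multiples[OF as, of w ?V])
        (auto simp: w(2) intro: exponents_add, auto simp: exponents_def)
    then show ?thesis using filtration_superset(1)[OF as] by blast
  qed
  have "monomial R as w \<odot>\<^bsub>M\<^esub> (monomial R as u \<odot>\<^bsub>M\<^esub> m) \<in> filtration as (n + k) ?V'"
    by (rule smult_additive_span[OF submodule_filtration[OF as] R.monomial_closed[OF as]
          filtration_gens_closed[OF as] step m(2)[unfolded filtration_def]])
  moreover have "monomial R as w \<odot>\<^bsub>M\<^esub> (monomial R as u \<odot>\<^bsub>M\<^esub> m) = monomial R as v \<odot>\<^bsub>M\<^esub> m"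
    using m(1) u w R.monomial_closed[OF as]
    by (simp add: R.monomial_add[OF as] smult_assoc1[symmetric] R.m_comm)
  ultimately show "m \<in> monomial_colon as v"
    using m(1) by (simp add: monomial_colon_def vs)
qed

theorem hilbert_samuel:
  assumes as: "set as \<subseteq> carrier R" and I: "I = Idl (set as)"
    and len: "has_length submodules (ideal_smult M I) (carrier M) l"
  shows "\<exists>L. eventually_polynomial L \<and>
    (\<forall>n. has_length submodules (ideal_smult M (ideal_power R I n)) (carrier M) (L n))"
proof -
  let ?E = "exponents (length as)"
  have "\<exists>k. has_length submodules (monomial_colon as u) (carrier M) k" if "length u = length as" for u
    using has_length_split[OF len submodule_monomial_colon[OF as]]
      ideal_smult_subset_monomial_colon[OF as that] submoduleE(1)[OF submodule_monomial_colon[OF as]] I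
    by blast
  then obtain f where f: "\<And>u. length u = length as \<Longrightarrow>
      has_length submodules (monomial_colon as u) (carrier M) (f u)"
    by metis
  \<comment> \<open>\<open>H n\<close> is shown below to be the length of
    \<open>I^n M / I^(n+1) M\<close>; the Samuel function is then the sequence of its partial
    sums.\<close>
  define H where "H n = (\<Sum>u\<in>?E n. f u)" for n
  have "antitone_lists (length as) f"
    unfolding antitone_lists_def
  proof (intro allI impI)
    fix u v :: "nat list" assume u: "length u = length as" and uv: "list_all2 (\<le>) u v"
    then have v: "length v = length as" by (simp add: list_all2_lengthD)
    obtain k l where k: "has_length submodules (monomial_colon as v) (carrier M) l" "f u = k + l"
      using has_length_split[OF f[OF u] submodule_monomial_colon[OF as] monomial_colon_mono[OF as u uv]]
        submoduleE(1)[OF submodule_monomial_colon[OF as]] by blast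
    then show "f v \<le> f u" using has_length_unique[OF f[OF v] k(1)] by simp
  qed
  then have H: "eventually_polynomial H"
    unfolding H_def by (rule eventually_polynomial_sum_exponents)
  have step: "has_length submodules (power_span as (Suc n)) (power_span as n) (H n)" for n
  proof -
    \<comment> \<open>The claim is made for all lexicographic initial segments \<open>V\<close>, so
      that the induction can remove the largest vector; the case needed is the full set
      \<open>?E n\<close>.\<close>
    have "has_length submodules (power_span as (Suc n)) (filtration as n V) (\<Sum>u\<in>V. f u)"
      if "finite V" "V \<subseteq> ?E n" "\<And>u v. u \<in> V \<Longrightarrow> v \<in> ?E n \<Longrightarrow> v < u \<Longrightarrow> v \<in> V" for V
      using that
    proof (induction V rule: finite_linorder_max_induct)
      case empty
      then show ?case
        using submodule_power_span[OF as] by (auto simp: filtration_empty[OF as] intro: has_length.base)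
    next
      case (insert u V)
      have "has_length submodules (power_span as (Suc n)) (filtration as n V) (\<Sum>u\<in>V. f u)"
      proof (rule insert.IH)
        show "w \<in> V" if "v \<in> V" "w \<in> ?E n" "w < v" for v w
          using insert.prems(2)[of v w] that insert.hyps(2) by fastforce
      qed (use insert.prems in auto)
      moreover have "has_length submodules (filtration as n V) (filtration as n (insert u V)) (f u)"
      proof -
        have u: "sum_list u = n" "length u = length as" using insert.prems by (auto simp: exponents_def)
        \<comment> \<open>Since \<open>u\<close> is the largest element of an initial segment, what
          remains is exactly the set of vectors below \<open>u\<close>, the one occurring in
          \<open>monomial_colon\<close>.\<close>
        have V: "V = {v \<in> ?E n. v < u}" using insert.prems insert.hyps(2) by auto
        have "has_length submodules
            {m \<in> carrier M. monomial R as u \<odot>\<^bsub>M\<^esub> m \<in> filtration as n V} (carrier M) (f u)"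
          using f[OF u(2)] unfolding monomial_colon_def u(1) V .
        then show ?thesis unfolding filtration_insert[OF as]
          by (rule has_length_smult[OF submodule_filtration[OF as] R.monomial_closed[OF as]])
      qed
      ultimately have "has_length submodules (power_span as (Suc n)) (filtration as n (insert u V))
          ((\<Sum>u\<in>V. f u) + f u)"
        by (rule has_length_trans)
      moreover have "u \<notin> V" using insert.hyps(2) by blast
      ultimately show ?case using insert.hyps(1) by (simp add: add.commute)
    qed
    from this[OF finite_exponents subset_refl] show ?thesis
      by (simp add: filtration_exponents[OF as] H_def)
  qed
  have "has_length submodules (power_span as n) (carrier M) (\<Sum>i<n. H i)" for n
  proof (induction n)
    case 0
    have "power_span as 0 = carrier M"
    proof
      show "carrier M \<subseteq> power_span as 0"
      proof
        fix x assume x: "x \<in> carrier M"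
        then have "\<one> \<odot>\<^bsub>M\<^esub> x \<in> ideal_smult M (ideal_power R I 0)"
          by (intro ideal_smult.prod) (auto simp: ideals_set_def)
        then show "x \<in> power_span as 0" unfolding ideal_smult_power[OF as I] using x by simp
      qed
    qed (rule submoduleE(1)[OF submodule_power_span[OF as]])
    then show ?case using carrier_is_submodule by (auto intro: has_length.base)
  next
    case (Suc n)
    then show ?case using has_length_trans[OF step Suc.IH] by (simp add: add.commute)
  qed
  then show ?thesis
    using eventually_polynomial_partial_sums[OF H] unfolding ideal_smult_power[OF as I]
    by (intro exI[of _ "\<lambda>n. \<Sum>i<n. H i"]) simp
qed

end

subsection \<open>Graded submodules and quotients\<close>

lemma (in abelian_group) homogeneous_decomp_imp_additive_span:
  assumes "homogeneous_decomp G A x f" "\<And>i. A i \<subseteq> carrier G"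
  shows "x \<in> additive_span G (\<Union>i. A i)"
proof -
  have f: "\<And>i. f i \<in> A i" "finite {i. f i \<noteq> \<zero>}" "x = (\<Oplus>i\<in>{i. f i \<noteq> \<zero>}. f i)"
    using assms(1) by (auto simp: homogeneous_decomp_def)
  have "(\<Oplus>i\<in>S. f i) \<in> additive_span G (\<Union>i. A i)" if "finite S" for S
    using that
  proof induction
    case empty
    then show ?case by (simp add: additive_span.zero)
  next
    case (insert i S)
    have "f \<in> insert i S \<rightarrow> carrier G" using f(1) assms(2) by blast
    then have "(\<Oplus>i\<in>insert i S. f i) = f i \<oplus> (\<Oplus>i\<in>S. f i)"
      using insert by (intro finsum_insert) auto
    then show ?case using insert f(1) by (auto intro: additive_span.add)
  qed
  then show ?thesis using f by simp
qed

text \<open>Adding a generator of degree \<open>i\<close> alters only the component of degree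
  \<open>i\<close>.\<close>

lemma (in abelian_group) additive_span_imp_homogeneous_decomp:
  assumes "x \<in> additive_span G (\<Union>i. A i)" "\<And>i. additive_subgroup (A i) G"
  shows "\<exists>f. homogeneous_decomp G A x f"
  using assms(1)
proof induction
  case zero
  show ?case
    using additive_subgroup.zero_closed[OF assms(2)]
    by (intro exI[of _ "\<lambda>_. \<zero>"]) (simp add: homogeneous_decomp_def)
next
  case (add g x)
  then obtain i f where g: "g \<in> A i" and "homogeneous_decomp G A x f" by auto
  then have f: "\<And>i. f i \<in> A i" "finite {i. f i \<noteq> \<zero>}" "x = (\<Oplus>i\<in>{i. f i \<noteq> \<zero>}. f i)"
    by (auto simp: homogeneous_decomp_def)
  have car: "\<And>i y. y \<in> A i \<Longrightarrow> y \<in> carrier G"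
    using additive_subgroup.a_Hcarr[OF assms(2)] by blast
  define f' where "f' = f(i := g \<oplus> f i)"
  let ?T = "{i. f i \<noteq> \<zero>} - {i}"
  have f': "f' j \<in> A j" for j
    using f(1) g additive_subgroup.a_closed[OF assms(2)] by (auto simp: f'_def)
  have fin: "finite ?T" using f(2) by simp
  \<comment> \<open>The support may gain or lose \<open>i\<close>, so both sums are compared over
    the support of \<open>f\<close> without \<open>i\<close>. Stating this for a general
    \<open>h\<close> covers \<open>f\<close> and \<open>f'\<close> at once.\<close>
  have eq: "(\<Oplus>j\<in>{j. h j \<noteq> \<zero>}. h j) = h i \<oplus> (\<Oplus>j\<in>?T. f j)" "finite {j. h j \<noteq> \<zero>}"
    if h: "\<And>j. h j \<in> A j" "\<And>j. j \<noteq> i \<Longrightarrow> h j = f j" for h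
  proof -
    have sub: "{j. h j \<noteq> \<zero>} \<subseteq> insert i ?T" using h(2) by auto
    then show "finite {j. h j \<noteq> \<zero>}" using fin by (meson finite.insertI finite_subset)
    have hc: "h \<in> S \<rightarrow> carrier G" "f \<in> S \<rightarrow> carrier G" for S using h(1) f(1) car by blast+
    have "(\<Oplus>j\<in>{j. h j \<noteq> \<zero>}. h j) = (\<Oplus>j\<in>insert i ?T. h j)"
      using sub fin hc by (intro add.finprod_mono_neutral_cong_left) auto
    also have "\<dots> = h i \<oplus> (\<Oplus>j\<in>?T. h j)"
      using fin hc h(1) car by (intro finsum_insert) auto
    also have "(\<Oplus>j\<in>?T. h j) = (\<Oplus>j\<in>?T. f j)"
      using hc h(2) by (intro finsum_cong') auto
    finally show "(\<Oplus>j\<in>{j. h j \<noteq> \<zero>}. h j) = h i \<oplus> (\<Oplus>j\<in>?T. f j)" .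
  qed
  have "(\<Oplus>j\<in>?T. f j) \<in> carrier G" using f(1) car by (intro finsum_closed) auto
  moreover have "x = f i \<oplus> (\<Oplus>j\<in>?T. f j)" using f(3) eq(1)[of f] f(1) by simp
  ultimately have "g \<oplus> x = f' i \<oplus> (\<Oplus>j\<in>?T. f j)"
    using car[OF f(1)[of i]] car[OF g] by (simp add: f'_def a_assoc)
  then have "homogeneous_decomp G A (g \<oplus> x) f'"
    using f' eq[of f'] by (auto simp: homogeneous_decomp_def f'_def)
  then show ?case by blast
qed

lemma (in abelian_group) homogeneous_decomp_iff_additive_span:
  assumes "\<And>i. additive_subgroup (A i) G"
  shows "(\<exists>f. homogeneous_decomp G A x f) \<longleftrightarrow> x \<in> additive_span G (\<Union>i. A i)"
  using homogeneous_decomp_imp_additive_span[of A x]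
    additive_span_imp_homogeneous_decomp[of x A] additive_subgroup.a_subset[OF assms] assms by blast

lemma (in abelian_group) additive_subgroup_Int:
  assumes "additive_subgroup H G" "additive_subgroup K G"
  shows "additive_subgroup (H \<inter> K) G"
  using add.subgroups_Inter_pair[of H K] assms by (simp add: additive_subgroup_def)

lemma additive_span_carrier_update: "additive_span (M\<lparr>carrier := P\<rparr>) G = additive_span M G"
proof
  show "additive_span (M\<lparr>carrier := P\<rparr>) G \<subseteq> additive_span M G"
  proof
    show "x \<in> additive_span M G" if "x \<in> additive_span (M\<lparr>carrier := P\<rparr>) G" for x
      using that by induction (auto intro: additive_span.intros)
  qed
  show "additive_span M G \<subseteq> additive_span (M\<lparr>carrier := P\<rparr>) G"
  proof
    show "x \<in> additive_span (M\<lparr>carrier := P\<rparr>) G" if "x \<in> additive_span M G" for x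
      using that
    proof induction
      case zero
      then show ?case using additive_span.zero[of "M\<lparr>carrier := P\<rparr>"] by simp
    next
      case (add g x)
      then show ?case using additive_span.add[of g G x "M\<lparr>carrier := P\<rparr>"] by simp
    qed
  qed
qed

section \<open>Modules with a family of component subgroups\<close>

abbreviation graded_submodules ::
    "('a, 'r) ring_scheme \<Rightarrow> ('a, 'b, 'm) module_scheme \<Rightarrow> (int \<Rightarrow> 'b set) \<Rightarrow> 'b set set" where
  "graded_submodules R M B \<equiv> {N. graded_submodule N R M B}"

text \<open>The components are not required to be independent. With all components equal to the
  whole module every submodule is graded, so the ungraded notions are a special case.\<close>

locale pregraded_module = Module.module R M
  for R (structure) and M (structure) and B +
  assumes component_subgroup: "additive_subgroup (B (i::int)) M"
begin

lemma submoduleI':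
  assumes "H \<subseteq> carrier M" "\<zero>\<^bsub>M\<^esub> \<in> H" "\<And>x y. x \<in> H \<Longrightarrow> y \<in> H \<Longrightarrow> x \<oplus>\<^bsub>M\<^esub> y \<in> H"
    and "\<And>a x. a \<in> carrier R \<Longrightarrow> x \<in> H \<Longrightarrow> a \<odot>\<^bsub>M\<^esub> x \<in> H"
  shows "submodule H R M"
proof (rule submoduleI)
  show "\<ominus>\<^bsub>M\<^esub> x \<in> H" if "x \<in> H" for x
    using assms(4)[of "\<ominus> \<one>" x] that assms(1) by (auto simp: smult_l_minus)
qed (use assms in auto)

lemma submodule_additive_subgroup: "submodule N R M \<Longrightarrow> additive_subgroup N M"
  by (simp add: additive_subgroup_def submodule.axioms(1))

lemma component_closed: "x \<in> B i \<Longrightarrow> x \<in> carrier M"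
  using additive_subgroup.a_Hcarr[OF component_subgroup] .

text \<open>Translates gradedness into span membership, so that later proofs argue by induction on
  spans.\<close>

lemma graded_submodule_iff:
  "graded_submodule N R M B \<longleftrightarrow> submodule N R M \<and> N \<subseteq> additive_span M (N \<inter> (\<Union>i. B i))"
proof (cases "submodule N R M")
  case True
  have "(\<exists>f. homogeneous_decomp M (\<lambda>i. N \<inter> B i) x f) \<longleftrightarrow> x \<in> additive_span M (N \<inter> (\<Union>i. B i))" for x
    using M.homogeneous_decomp_iff_additive_span[of "\<lambda>i. N \<inter> B i" x]
      M.additive_subgroup_Int[OF submodule_additive_subgroup[OF True] component_subgroup]
    by simp
  then show ?thesis using True by (auto simp: graded_submodule_def)
qed (simp add: graded_submodule_def)

lemma graded_submoduleD:
  assumes "graded_submodule N R M B"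
  shows "submodule N R M" "N \<subseteq> additive_span M (N \<inter> (\<Union>i. B i))"
  using assms by (simp_all add: graded_submodule_iff)

lemma restrict_pregraded:
  assumes "submodule P R M"
  shows "pregraded_module R (M\<lparr>carrier := P\<rparr>) (\<lambda>i. P \<inter> B i)"
proof -
  interpret P: Module.module R "M\<lparr>carrier := P\<rparr>"
    using submodule.submodule_is_module[OF assms] module_axioms by blast
  show ?thesis
  proof (intro pregraded_module.intro pregraded_module_axioms.intro P.module_axioms)
    fix i
    have "subgroup (P \<inter> B i) (add_monoid M)"
      using M.additive_subgroup_Int[OF submodule_additive_subgroup[OF assms] component_subgroup]
      by (simp add: additive_subgroup_def)
    then have "subgroup (P \<inter> B i) ((add_monoid M)\<lparr>carrier := P\<rparr>)"
      using M.add.subgroup_incl[of "P \<inter> B i" P] submodule.axioms(1)[OF assms] by auto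
    then show "additive_subgroup (P \<inter> B i) (M\<lparr>carrier := P\<rparr>)"
      by (simp add: additive_subgroup_def)
  qed
qed

lemma restrict_submodule_iff:
  assumes P: "submodule P R M"
  shows "submodule Y R (M\<lparr>carrier := P\<rparr>) \<longleftrightarrow> submodule Y R M \<and> Y \<subseteq> P"
proof -
  interpret P: pregraded_module R "M\<lparr>carrier := P\<rparr>" "\<lambda>i. P \<inter> B i"
    by (rule restrict_pregraded[OF P])
  show ?thesis
  proof
    assume Y: "submodule Y R (M\<lparr>carrier := P\<rparr>)"
    then have "Y \<subseteq> P" using P.submoduleE(1) by fastforce
    moreover have "submodule Y R M"
      using P.submodule_zero[OF Y] P.submoduleE(4,5)[OF Y] \<open>Y \<subseteq> P\<close> submoduleE(1)[OF P]
      by (intro submoduleI') auto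
    ultimately show "submodule Y R M \<and> Y \<subseteq> P" by blast
  next
    assume "submodule Y R M \<and> Y \<subseteq> P"
    then have Y: "submodule Y R M" "Y \<subseteq> P" by auto
    show "submodule Y R (M\<lparr>carrier := P\<rparr>)"
      using submodule_zero[OF Y(1)] submoduleE(4,5)[OF Y(1)] Y(2)
      by (intro P.submoduleI') auto
  qed
qed

lemma restrict_graded_submodule_iff:
  assumes P: "submodule P R M"
  shows "graded_submodule Y R (M\<lparr>carrier := P\<rparr>) (\<lambda>i. P \<inter> B i) \<longleftrightarrow> graded_submodule Y R M B \<and> Y \<subseteq> P"
proof -
  interpret P: pregraded_module R "M\<lparr>carrier := P\<rparr>" "\<lambda>i. P \<inter> B i"
    by (rule restrict_pregraded[OF P])
  have "Y \<inter> (\<Union>i. P \<inter> B i) = Y \<inter> (\<Union>i. B i)" if "Y \<subseteq> P" using that by blast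
  then show ?thesis
    unfolding P.graded_submodule_iff graded_submodule_iff restrict_submodule_iff[OF P]
      additive_span_carrier_update by auto
qed

section \<open>The correspondence between graded submodules of a quotient and those above
  \<open>N\<close>\<close>

context
  fixes N assumes N: "graded_submodule N R M B"
begin

abbreviation (input) "Q \<equiv> quot_module M N"

lemma N_submodule: "submodule N R M"
  using graded_submoduleD(1)[OF N] .

interpretation AN: abelian_subgroup N M
  by (rule abelian_subgroupI3[OF submodule_additive_subgroup[OF N_submodule] M.abelian_group_axioms])

lemma quot_carrier: "carrier Q = (\<lambda>x. N +>\<^bsub>M\<^esub> x) ` carrier M"
  by (auto simp: quot_module_def A_RCOSETS_def')

lemma quot_zero: "\<zero>\<^bsub>Q\<^esub> = N +>\<^bsub>M\<^esub> \<zero>\<^bsub>M\<^esub>"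
  using AN.a_subset by (simp add: quot_module_def)

lemma quot_add:
  "x \<in> carrier M \<Longrightarrow> y \<in> carrier M \<Longrightarrow> (N +>\<^bsub>M\<^esub> x) \<oplus>\<^bsub>Q\<^esub> (N +>\<^bsub>M\<^esub> y) = N +>\<^bsub>M\<^esub> (x \<oplus>\<^bsub>M\<^esub> y)"
  using AN.a_rcos_sum by (simp add: quot_module_def)

lemma coset_eq_iff:
  assumes "x \<in> carrier M" "y \<in> carrier M"
  shows "N +>\<^bsub>M\<^esub> x = N +>\<^bsub>M\<^esub> y \<longleftrightarrow> x \<ominus>\<^bsub>M\<^esub> y \<in> N"
  using AN.a_rcos_self[OF assms(1)] AN.a_rcos_module[OF assms(2,1)]
    AN.a_repr_independence'[of x y] assms(2) unfolding M.minus_eq by metis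

text \<open>A submodule containing \<open>N\<close> is a union of cosets of \<open>N\<close>, so it
  can be recovered from its image.\<close>

lemma coset_mem_image_iff:
  assumes "submodule Y R M" "N \<subseteq> Y" "x \<in> carrier M"
  shows "N +>\<^bsub>M\<^esub> x \<in> (\<lambda>x. N +>\<^bsub>M\<^esub> x) ` Y \<longleftrightarrow> x \<in> Y"
proof
  assume "N +>\<^bsub>M\<^esub> x \<in> (\<lambda>x. N +>\<^bsub>M\<^esub> x) ` Y"
  then obtain y where y: "y \<in> Y" "N +>\<^bsub>M\<^esub> x = N +>\<^bsub>M\<^esub> y" by blast
  have yc: "y \<in> carrier M" using y submoduleE(1)[OF assms(1)] by blast
  have "x \<ominus>\<^bsub>M\<^esub> y \<in> Y" using coset_eq_iff[OF assms(3) yc] y assms(2) by blast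
  then have "x \<ominus>\<^bsub>M\<^esub> y \<oplus>\<^bsub>M\<^esub> y \<in> Y" using y submoduleE(5)[OF assms(1)] by blast
  then show "x \<in> Y" using assms(3) yc by (simp add: M.minus_eq M.a_assoc M.l_neg)
qed blast

lemma image_N: "(\<lambda>x. N +>\<^bsub>M\<^esub> x) ` N = {\<zero>\<^bsub>Q\<^esub>}"
proof -
  have "N +>\<^bsub>M\<^esub> x = \<zero>\<^bsub>Q\<^esub>" if "x \<in> N" for x
    using that subsetD[OF submoduleE(1)[OF N_submodule] that] coset_eq_iff[of x "\<zero>\<^bsub>M\<^esub>"]
    by (simp add: quot_zero M.minus_eq del: M.a_coset_add_zero)
  then show ?thesis using submodule_zero[OF N_submodule] by blast
qed

lemma quot_pregraded: "pregraded_module R Q (quot_grading M N B)"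
proof -
  interpret Q: Module.module R Q by (rule quot_module_is_module[OF N_submodule])
  show ?thesis
  proof (intro pregraded_module.intro pregraded_module_axioms.intro Q.module_axioms)
    fix i
    interpret Bi: additive_subgroup "B i" M by (rule component_subgroup)
    show "additive_subgroup (quot_grading M N B i) Q"
    proof (rule additive_subgroupI, rule Q.M.add.subgroupI)
      show "quot_grading M N B i \<subseteq> carrier Q"
        by (auto simp: quot_grading_def quot_carrier)
      show "quot_grading M N B i \<noteq> {}"
        using Bi.zero_closed unfolding quot_grading_def by blast
      show "\<ominus>\<^bsub>Q\<^esub> X \<in> quot_grading M N B i" if X: "X \<in> quot_grading M N B i" for X
      proof -
        obtain x where x: "x \<in> B i" "X = N +>\<^bsub>M\<^esub> x" using X by (auto simp: quot_grading_def)
        have xc: "x \<in> carrier M" using x component_closed by blast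
        then have "X \<oplus>\<^bsub>Q\<^esub> (N +>\<^bsub>M\<^esub> (\<ominus>\<^bsub>M\<^esub> x)) = \<zero>\<^bsub>Q\<^esub>"
          using x by (simp add: quot_add M.r_neg quot_zero del: M.a_coset_add_zero)
        then have "\<ominus>\<^bsub>Q\<^esub> X = N +>\<^bsub>M\<^esub> (\<ominus>\<^bsub>M\<^esub> x)"
          using x xc quot_carrier by (intro Q.M.minus_equality) (auto simp: Q.M.a_comm)
        moreover have "\<ominus>\<^bsub>M\<^esub> x \<in> B i" using x(1) by (rule Bi.a_inv_closed)
        ultimately show ?thesis by (auto simp: quot_grading_def)
      qed
      show "X \<oplus>\<^bsub>Q\<^esub> Y \<in> quot_grading M N B i"
        if "X \<in> quot_grading M N B i" "Y \<in> quot_grading M N B i" for X Y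
        using that Bi.a_closed by (auto simp: quot_grading_def quot_add component_closed)
    qed
  qed
qed

interpretation QM: pregraded_module R Q "quot_grading M N B"
  by (rule quot_pregraded)

lemma graded_submodule_image:
  assumes Y: "graded_submodule Y R M B"
  shows "graded_submodule ((\<lambda>x. N +>\<^bsub>M\<^esub> x) ` Y) R Q (quot_grading M N B)"
proof -
  let ?p = "\<lambda>x. N +>\<^bsub>M\<^esub> x"
  note Ys = graded_submoduleD(1)[OF Y]
  have Yc: "\<And>y. y \<in> Y \<Longrightarrow> y \<in> carrier M" using submoduleE(1)[OF Ys] by blast
  have "submodule (?p ` Y) R Q"
  proof (rule QM.submoduleI')
    show "?p ` Y \<subseteq> carrier Q" using Yc by (auto simp: quot_carrier)
    show "\<zero>\<^bsub>Q\<^esub> \<in> ?p ` Y" using submodule_zero[OF Ys] quot_zero by blast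
    show "a \<oplus>\<^bsub>Q\<^esub> b \<in> ?p ` Y" if "a \<in> ?p ` Y" "b \<in> ?p ` Y" for a b
      using that Yc submoduleE(5)[OF Ys] by (auto simp: quot_add)
    show "a \<odot>\<^bsub>Q\<^esub> b \<in> ?p ` Y" if "a \<in> carrier R" "b \<in> ?p ` Y" for a b
      using that Yc submoduleE(4)[OF Ys] by (auto simp: quot_module_smult[OF N_submodule])
  qed
  moreover have "?p y \<in> additive_span Q (?p ` Y \<inter> (\<Union>i. quot_grading M N B i))"
    if "y \<in> additive_span M (Y \<inter> (\<Union>i. B i))" for y
    using that
  proof induction
    case zero
    then show ?case using additive_span.zero quot_zero by metis
  next
    case (add g x)
    have "x \<in> carrier M"
      by (rule M.additive_span_closed[OF _ add.hyps(2)]) (use Yc in blast)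
    then have "?p (g \<oplus>\<^bsub>M\<^esub> x) = ?p g \<oplus>\<^bsub>Q\<^esub> ?p x" using add.hyps(1) Yc by (simp add: quot_add)
    moreover have "?p g \<in> ?p ` Y \<inter> (\<Union>i. quot_grading M N B i)"
      using add.hyps(1) by (auto simp: quot_grading_def)
    ultimately show ?case using add.IH additive_span.add by metis
  qed
  ultimately show ?thesis
    unfolding QM.graded_submodule_iff using graded_submoduleD(2)[OF Y] by blast
qed

text \<open>Homogeneous cosets are lifted one at a time to homogeneous elements; the error left at
  the end lies in \<open>N\<close>, which is itself graded.\<close>

lemma graded_submodule_preimage:
  assumes X: "graded_submodule X R Q (quot_grading M N B)"
  defines "Y \<equiv> {x \<in> carrier M. N +>\<^bsub>M\<^esub> x \<in> X}"
  shows "graded_submodule Y R M B" "N \<subseteq> Y" "(\<lambda>x. N +>\<^bsub>M\<^esub> x) ` Y = X"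
proof -
  let ?p = "\<lambda>x. N +>\<^bsub>M\<^esub> x"
  note Xs = QM.graded_submoduleD(1)[OF X]
  note N_sub = submoduleE(1)[OF N_submodule]
  have N_eq: "?p x = \<zero>\<^bsub>Q\<^esub> \<longleftrightarrow> x \<in> N" if "x \<in> carrier M" for x
    using coset_mem_image_iff[OF N_submodule subset_refl that] by (simp add: image_N)
  show NY: "N \<subseteq> Y"
  proof
    fix x assume "x \<in> N"
    then show "x \<in> Y"
      using N_eq[of x] QM.submodule_zero[OF Xs] N_sub by (auto simp: Y_def)
  qed
  show "?p ` Y = X"
  proof
    show "X \<subseteq> ?p ` Y"
    proof
      fix x assume x: "x \<in> X"
      then have "x \<in> carrier Q" using QM.submoduleE(1)[OF Xs] by blast
      then show "x \<in> ?p ` Y" using x unfolding quot_carrier Y_def by blast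
    qed
  qed (auto simp: Y_def)
  have Ys: "submodule Y R M"
  proof (rule submoduleI')
    show "\<zero>\<^bsub>M\<^esub> \<in> Y" using NY submodule_zero[OF N_submodule] by blast
    show "x \<oplus>\<^bsub>M\<^esub> y \<in> Y" if "x \<in> Y" "y \<in> Y" for x y
      using that QM.submoduleE(5)[OF Xs] by (auto simp: Y_def quot_add[symmetric])
    show "a \<odot>\<^bsub>M\<^esub> x \<in> Y" if "a \<in> carrier R" "x \<in> Y" for a x
      using that QM.submoduleE(4)[OF Xs, of a "?p x"]
      by (auto simp: Y_def quot_module_smult[OF N_submodule])
  qed (auto simp: Y_def)
  \<comment> \<open>The representative \<open>y\<close> stays arbitrary in the induction: once the
    lift \<open>b\<close> of the first summand is subtracted, \<open>y - b\<close> represents the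
    remaining sum.\<close>
  have "y \<in> additive_span M (Y \<inter> (\<Union>i. B i))"
    if "z \<in> additive_span Q (X \<inter> (\<Union>i. quot_grading M N B i))" "y \<in> carrier M" "?p y = z" for y z
    using that
  proof (induction arbitrary: y)
    case zero
    then have "y \<in> N" using N_eq by simp
    then show ?case
      using graded_submoduleD(2)[OF N] additive_span_mono[of "N \<inter> (\<Union>i. B i)" "Y \<inter> (\<Union>i. B i)" M] NY
      by blast
  next
    case (add g z)
    from add.hyps(1) obtain i b where b: "b \<in> B i" "g = ?p b" "g \<in> X"
      by (auto simp: quot_grading_def)
    have bc: "b \<in> carrier M" using b component_closed by blast
    have "z \<in> carrier Q"
      by (rule QM.M.additive_span_closed[OF _ add.hyps(2)]) (use QM.submoduleE(1)[OF Xs] in blast)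
    then obtain w where w: "w \<in> carrier M" "z = ?p w" by (auto simp: quot_carrier)
    have "?p y = ?p (b \<oplus>\<^bsub>M\<^esub> w)" using add.prems b w bc by (simp add: quot_add)
    then have "y \<ominus>\<^bsub>M\<^esub> (b \<oplus>\<^bsub>M\<^esub> w) \<in> N" using coset_eq_iff add.prems w bc by auto
    moreover have "y \<ominus>\<^bsub>M\<^esub> (b \<oplus>\<^bsub>M\<^esub> w) = (y \<ominus>\<^bsub>M\<^esub> b) \<ominus>\<^bsub>M\<^esub> w"
      using add.prems w bc by (simp add: M.minus_eq M.minus_add M.a_ac)
    ultimately have "?p (y \<ominus>\<^bsub>M\<^esub> b) = z"
      using coset_eq_iff[of "y \<ominus>\<^bsub>M\<^esub> b" w] add.prems w bc by auto
    then have "y \<ominus>\<^bsub>M\<^esub> b \<in> additive_span M (Y \<inter> (\<Union>i. B i))"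
      using add.IH[of "y \<ominus>\<^bsub>M\<^esub> b"] add.prems bc by auto
    moreover have "b \<in> Y \<inter> (\<Union>i. B i)" using b bc by (auto simp: Y_def)
    ultimately have "b \<oplus>\<^bsub>M\<^esub> (y \<ominus>\<^bsub>M\<^esub> b) \<in> additive_span M (Y \<inter> (\<Union>i. B i))"
      by (intro additive_span.add)
    moreover have "b \<oplus>\<^bsub>M\<^esub> (y \<ominus>\<^bsub>M\<^esub> b) = y"
      using add.prems(1) bc M.a_lcomm[of b y "\<ominus>\<^bsub>M\<^esub> b"] by (simp add: M.minus_eq M.r_neg)
    ultimately show ?case by simp
  qed
  then have "Y \<subseteq> additive_span M (Y \<inter> (\<Union>i. B i))"
    using QM.graded_submoduleD(2)[OF X] by (auto simp: Y_def)
  then show "graded_submodule Y R M B" using Ys by (simp add: graded_submodule_iff)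
qed

lemma image_subset_iff:
  assumes "submodule X R M" "submodule Y R M" "N \<subseteq> Y"
  shows "(\<lambda>x. N +>\<^bsub>M\<^esub> x) ` X \<subseteq> (\<lambda>x. N +>\<^bsub>M\<^esub> x) ` Y \<longleftrightarrow> X \<subseteq> Y"
  using coset_mem_image_iff[OF assms(2,3)] submoduleE(1)[OF assms(1)] by blast

text \<open>Image and preimage under the projection are mutually inverse order isomorphisms between
  the two intervals; each gives one direction.\<close>

lemma has_length_quot:
  "has_length (graded_submodules R Q (quot_grading M N B)) {\<zero>\<^bsub>Q\<^esub>} (carrier Q) n \<longleftrightarrow>
   has_length (graded_submodules R M B) N (carrier M) n"
proof
  let ?p = "\<lambda>Y. (\<lambda>x. N +>\<^bsub>M\<^esub> x) ` Y" and ?q = "\<lambda>X. {x \<in> carrier M. N +>\<^bsub>M\<^esub> x \<in> X}"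
  have pq: "?p (?q X) = X" if "graded_submodule X R Q (quot_grading M N B)" for X
    using graded_submodule_preimage(3)[OF that] .
  have qp: "?q (?p Y) = Y" if "graded_submodule Y R M B" "N \<subseteq> Y" for Y
    using coset_mem_image_iff[OF graded_submoduleD(1)[OF that(1)] that(2)]
      submoduleE(1)[OF graded_submoduleD(1)[OF that(1)]] by blast
  show "has_length (graded_submodules R Q (quot_grading M N B)) {\<zero>\<^bsub>Q\<^esub>} (carrier Q) n"
    if len: "has_length (graded_submodules R M B) N (carrier M) n"
  proof -
    have "has_length (graded_submodules R Q (quot_grading M N B)) (?p N) (?p (carrier M)) n"
    proof (rule has_length_order_iso[OF len])
      fix Z assume "Z \<in> graded_submodules R Q (quot_grading M N B)"
      then show "\<exists>X\<in>graded_submodules R M B. N \<subseteq> X \<and> X \<subseteq> carrier M \<and> ?p X = Z"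
        using graded_submodule_preimage[of Z] by (intro bexI[of _ "?q Z"]) auto
    next
      show "?p X \<subseteq> ?p Y \<longleftrightarrow> X \<subseteq> Y"
        if "X \<in> graded_submodules R M B" "Y \<in> graded_submodules R M B" "N \<subseteq> Y" for X Y
        by (rule image_subset_iff) (use that graded_submoduleD(1) in simp_all)
    qed (use graded_submodule_image in auto)
    then show ?thesis by (simp only: image_N quot_carrier)
  qed
  show "has_length (graded_submodules R M B) N (carrier M) n"
    if len: "has_length (graded_submodules R Q (quot_grading M N B)) {\<zero>\<^bsub>Q\<^esub>} (carrier Q) n"
  proof -
    have q0: "?q {\<zero>\<^bsub>Q\<^esub>} = N" using qp[OF N subset_refl] by (simp only: image_N)
    have q1: "?q (carrier Q) = carrier M" by (auto simp: quot_carrier)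
    have "has_length (graded_submodules R M B) (?q {\<zero>\<^bsub>Q\<^esub>}) (?q (carrier Q)) n"
    proof (rule has_length_order_iso[OF len])
      show "?q X \<in> graded_submodules R M B"
        if "X \<in> graded_submodules R Q (quot_grading M N B)" for X
        using that graded_submodule_preimage(1) by simp
    next
      fix X Y assume "X \<in> graded_submodules R Q (quot_grading M N B)"
        "Y \<in> graded_submodules R Q (quot_grading M N B)"
      then have eq: "?p (?q X) = X" "?p (?q Y) = Y" using pq by auto
      show "?q X \<subseteq> ?q Y \<longleftrightarrow> X \<subseteq> Y"
      proof
        assume "?q X \<subseteq> ?q Y"
        then have "?p (?q X) \<subseteq> ?p (?q Y)" by (rule image_mono)
        then show "X \<subseteq> Y" unfolding eq .
      qed blast
    next
      fix Z assume Z: "Z \<in> graded_submodules R M B" "?q {\<zero>\<^bsub>Q\<^esub>} \<subseteq> Z" "Z \<subseteq> ?q (carrier Q)"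
      then have "N \<subseteq> Z" using q0 by blast
      moreover have "?p Z \<subseteq> carrier Q" using Z(3) by blast
      moreover have "{\<zero>\<^bsub>Q\<^esub>} \<subseteq> ?p Z" using image_mono[OF \<open>N \<subseteq> Z\<close>, of "\<lambda>x. N +>\<^bsub>M\<^esub> x"] unfolding image_N .
      ultimately show "\<exists>X\<in>graded_submodules R Q (quot_grading M N B).
          {\<zero>\<^bsub>Q\<^esub>} \<subseteq> X \<and> X \<subseteq> carrier Q \<and> ?q X = Z"
        using Z(1) qp[of Z] graded_submodule_image[of Z]
        by (intro bexI[of _ "?p Z"] conjI) simp_all
    qed
    then show ?thesis by (simp only: q0 q1)
  qed
qed

lemma star_simple_quot_iff:
  assumes "N \<noteq> carrier M"
  shows "star_simple_module R Q (quot_grading M N B) \<longleftrightarrow>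
    (\<forall>Y. graded_submodule Y R M B \<and> N \<subseteq> Y \<longrightarrow> Y = N \<or> Y = carrier M)"
proof -
  let ?p = "\<lambda>Y. (\<lambda>x. N +>\<^bsub>M\<^esub> x) ` Y"
  have inj: "?p X = ?p Y \<longleftrightarrow> X = Y"
    if "submodule X R M" "submodule Y R M" "N \<subseteq> X" "N \<subseteq> Y" for X Y
    using image_subset_iff[OF that(1,2,4)] image_subset_iff[OF that(2,1,3)] by blast
  note sub = N_submodule carrier_is_submodule submoduleE(1)[OF N_submodule]
  have ne: "carrier Q \<noteq> {\<zero>\<^bsub>Q\<^esub>}"
    using inj[of "carrier M" N] assms sub unfolding image_N quot_carrier by blast
  have "(\<forall>X. graded_submodule X R Q (quot_grading M N B) \<longrightarrow> X = {\<zero>\<^bsub>Q\<^esub>} \<or> X = carrier Q) \<longleftrightarrow>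
    (\<forall>Y. graded_submodule Y R M B \<and> N \<subseteq> Y \<longrightarrow> ?p Y = {\<zero>\<^bsub>Q\<^esub>} \<or> ?p Y = carrier Q)"
    (is "?l \<longleftrightarrow> ?r")
  proof
    assume ?r
    show ?l
    proof (intro allI impI)
      fix X assume X: "graded_submodule X R Q (quot_grading M N B)"
      show "X = {\<zero>\<^bsub>Q\<^esub>} \<or> X = carrier Q"
        using \<open>?r\<close>[rule_format, OF conjI[OF graded_submodule_preimage(1,2)[OF X]]]
        unfolding graded_submodule_preimage(3)[OF X] .
    qed
  qed (use graded_submodule_image in blast)
  also have "\<dots> \<longleftrightarrow> (\<forall>Y. graded_submodule Y R M B \<and> N \<subseteq> Y \<longrightarrow> Y = N \<or> Y = carrier M)"
  proof -
    have "?p Y = {\<zero>\<^bsub>Q\<^esub>} \<longleftrightarrow> Y = N" "?p Y = carrier Q \<longleftrightarrow> Y = carrier M"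
      if "graded_submodule Y R M B" "N \<subseteq> Y" for Y
      using inj[of Y N] inj[of Y "carrier M"] sub graded_submoduleD(1)[OF that(1)] that(2)
      unfolding image_N quot_carrier by simp_all
    then show ?thesis by (intro iff_allI imp_cong refl) simp
  qed
  finally show ?thesis using ne by (simp add: star_simple_module_def)
qed

end

text \<open>The correspondence applied with \<open>P\<close> as the ambient module turns
  star-simplicity of a factor into a condition on the order of submodules.\<close>

lemma star_simple_iff_covers:
  assumes N: "graded_submodule N R M B" and P: "graded_submodule P R M B" and NP: "N \<subset> P"
  shows "star_simple_module R (quot_module (M\<lparr>carrier := P\<rparr>) N) (quot_grading M N (\<lambda>i. P \<inter> B i)) \<longleftrightarrow>
    covers (graded_submodules R M B) N P"
proof -
  note Ps = graded_submoduleD(1)[OF P]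
  interpret P: pregraded_module R "M\<lparr>carrier := P\<rparr>" "\<lambda>i. P \<inter> B i"
    by (rule restrict_pregraded[OF Ps])
  \<comment> \<open>The quotient grading of a factor is written with cosets formed in
    \<open>M\<close>; they agree with those formed in the restricted module, as a coset does not
    depend on the carrier.\<close>
  have "quot_grading M N (\<lambda>i. P \<inter> B i) = quot_grading (M\<lparr>carrier := P\<rparr>) N (\<lambda>i. P \<inter> B i)"
    by (simp add: quot_grading_def fun_eq_iff a_r_coset_def r_coset_def)
  then have "star_simple_module R (quot_module (M\<lparr>carrier := P\<rparr>) N) (quot_grading M N (\<lambda>i. P \<inter> B i)) \<longleftrightarrow>
    (\<forall>Y. graded_submodule Y R (M\<lparr>carrier := P\<rparr>) (\<lambda>i. P \<inter> B i) \<and> N \<subseteq> Y \<longrightarrow> Y = N \<or> Y = P)"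
    using P.star_simple_quot_iff[of N] N NP restrict_graded_submodule_iff[OF Ps] by auto
  also have "\<dots> \<longleftrightarrow> covers (graded_submodules R M B) N P"
    unfolding restrict_graded_submodule_iff[OF Ps] covers_def using N P NP by auto
  finally show ?thesis .
qed

lemma star_composition_series_iff:
  "(\<exists>C. star_composition_series R M B C n) \<longleftrightarrow>
    has_length (graded_submodules R M B) {\<zero>\<^bsub>M\<^esub>} (carrier M) n"
  unfolding star_composition_series_def has_length_iff_chain
proof (intro iff_exI)
  fix C
  have key: "(\<forall>k<n. C k \<subset> C (Suc k) \<and> star_simple_module R (quot_module (M\<lparr>carrier := C (Suc k)\<rparr>) (C k))
          (quot_grading M (C k) (\<lambda>i. C (Suc k) \<inter> B i))) \<longleftrightarrow>
      (\<forall>k<n. covers (graded_submodules R M B) (C k) (C (Suc k)))"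
    if "\<forall>k\<le>n. graded_submodule (C k) R M B"
    using that star_simple_iff_covers by (metis Suc_leI covers_def less_imp_le)
  show "(C 0 = {\<zero>\<^bsub>M\<^esub>} \<and> C n = carrier M \<and> (\<forall>k\<le>n. graded_submodule (C k) R M B) \<and>
      (\<forall>k<n. C k \<subset> C (Suc k) \<and> star_simple_module R (quot_module (M\<lparr>carrier := C (Suc k)\<rparr>) (C k))
          (quot_grading M (C k) (\<lambda>i. C (Suc k) \<inter> B i)))) \<longleftrightarrow>
      (C 0 = {\<zero>\<^bsub>M\<^esub>} \<and> C n = carrier M \<and> (\<forall>k\<le>n. C k \<in> graded_submodules R M B) \<and>
      (\<forall>k<n. covers (graded_submodules R M B) (C k) (C (Suc k))))"
    unfolding mem_Collect_eq by (intro conj_cong refl key)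
qed

lemma star_composition_series_quot_iff:
  assumes "graded_submodule N R M B"
  shows "(\<exists>C. star_composition_series R (quot_module M N) (quot_grading M N B) C n) \<longleftrightarrow>
    has_length (graded_submodules R M B) N (carrier M) n"
  using pregraded_module.star_composition_series_iff[OF quot_pregraded[OF assms]]
    has_length_quot[OF assms] by simp

end

section \<open>Ordinary composition series as the case in which every component is the whole
  module\<close>

lemma (in Module.module) pregraded_carrier: "pregraded_module R M (\<lambda>_. carrier M)"
proof (intro pregraded_module.intro pregraded_module_axioms.intro module_axioms)
  show "additive_subgroup (carrier M) M"
    using carrier_is_submodule by (simp add: additive_subgroup_def submodule.axioms(1))
qed

lemma (in Module.module) graded_submodule_carrier:
  "graded_submodule N R M (\<lambda>_. carrier M) \<longleftrightarrow> submodule N R M"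
proof -
  interpret P: pregraded_module R M "\<lambda>_. carrier M" by (rule pregraded_carrier)
  have "N \<subseteq> additive_span M (N \<inter> carrier M)" if "submodule N R M"
    using M.additive_span_superset[of "N \<inter> carrier M"] submoduleE(1)[OF that] by blast
  then show ?thesis unfolding P.graded_submodule_iff by auto
qed

lemma quot_grading_carrier: "quot_grading M N (\<lambda>_. carrier M) = (\<lambda>_. carrier (quot_module M N))"
  by (auto simp: quot_grading_def quot_module_def A_RCOSETS_def' fun_eq_iff)

text \<open>Lets the ungraded length of a quotient inherit the correspondence proved for graded
  submodules.\<close>

lemma (in Module.module) composition_series_carrier:
  "composition_series R M C n \<longleftrightarrow> star_composition_series R M (\<lambda>_. carrier M) C n"
proof -
  have "simple_module R (quot_module (M\<lparr>carrier := C (Suc k)\<rparr>) (C k)) \<longleftrightarrow>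
      star_simple_module R (quot_module (M\<lparr>carrier := C (Suc k)\<rparr>) (C k))
          (quot_grading M (C k) (\<lambda>i. C (Suc k) \<inter> carrier M))"
    if sub: "submodule (C k) R M" "submodule (C (Suc k)) R M" "C k \<subset> C (Suc k)" for k
  proof -
    let ?P = "M\<lparr>carrier := C (Suc k)\<rparr>"
    interpret M: pregraded_module R M "\<lambda>_. carrier M" by (rule pregraded_carrier)
    interpret P: Module.module R ?P
      using submodule.submodule_is_module[OF sub(2)] module_axioms by blast
    interpret Q: Module.module R "quot_module ?P (C k)"
      using P.quot_module_is_module M.restrict_submodule_iff[OF sub(2)] sub by auto
    have "C (Suc k) \<inter> carrier M = C (Suc k)" using submoduleE(1)[OF sub(2)] by blast
    then have "quot_grading M (C k) (\<lambda>i. C (Suc k) \<inter> carrier M) = quot_grading ?P (C k) (\<lambda>_. carrier ?P)"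
      by (simp add: quot_grading_def fun_eq_iff a_r_coset_def r_coset_def)
    then show ?thesis
      unfolding simple_module_def star_simple_module_def
      by (simp only: quot_grading_carrier Q.graded_submodule_carrier)
  qed
  then show ?thesis
    unfolding composition_series_def star_composition_series_def graded_submodule_carrier
    by (metis Suc_leI less_imp_le)
qed

lemma (in Module.module) composition_series_quot_iff:
  assumes "submodule N R M"
  shows "(\<exists>C. composition_series R (quot_module M N) C n) \<longleftrightarrow> has_length submodules N (carrier M) n"
proof -
  interpret P: pregraded_module R M "\<lambda>_. carrier M" by (rule pregraded_carrier)
  interpret Q: Module.module R "quot_module M N" by (rule quot_module_is_module[OF assms])
  show ?thesis
    using P.star_composition_series_quot_iff[of N n] assms
    by (simp add: graded_submodule_carrier Q.composition_series_carrier quot_grading_carrier)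
qed

subsection \<open>Graded modules over positively graded rings\<close>

context graded_ring
begin

lemma ring_component_subgroup: "additive_subgroup (A i) R"
  using ring_direct_sum by (simp add: direct_sum_decomp_def)

lemma ring_component_closed: "a \<in> A i \<Longrightarrow> a \<in> carrier R"
  using additive_subgroup.a_Hcarr[OF ring_component_subgroup] .

lemma carrier_ring_span: "carrier R \<subseteq> additive_span R (\<Union>i. A i)"
proof
  fix x assume "x \<in> carrier R"
  then obtain f where "homogeneous_decomp R A x f"
    using ring_direct_sum unfolding direct_sum_decomp_def by blast
  then show "x \<in> additive_span R (\<Union>i. A i)"
    by (rule homogeneous_decomp_imp_additive_span) (use ring_component_closed in blast)
qed

text \<open>Gradedness in terms of spans, which unlike \<^const>\<open>homogeneous_decomp\<close>
  requires no bookkeeping of supports.\<close>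

definition spanned_by_homogeneous :: "'a set \<Rightarrow> bool" where
  "spanned_by_homogeneous I \<longleftrightarrow> I \<subseteq> additive_span R (I \<inter> (\<Union>i. A i))"

lemma graded_ideal_spanned:
  assumes "graded_ideal I R A"
  shows "spanned_by_homogeneous I"
  unfolding spanned_by_homogeneous_def
proof
  fix x assume "x \<in> I"
  then obtain f where "homogeneous_decomp R (\<lambda>i. I \<inter> A i) x f"
    using assms unfolding graded_ideal_def by blast
  then have "x \<in> additive_span R (\<Union>i. I \<inter> A i)"
    by (rule homogeneous_decomp_imp_additive_span) (use ring_component_closed in blast)
  then show "x \<in> additive_span R (I \<inter> (\<Union>i. A i))" by simp
qed

text \<open>Products of homogeneous elements are homogeneous. The claim spreads to arbitrary factors
  one at a time, because the elements \<open>y\<close> with \<open>g \<otimes> y\<close> in the span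
  are closed under addition, and likewise on the left.\<close>

lemma spanned_by_homogeneous_prod:
  assumes I: "ideal I R" "spanned_by_homogeneous I" and J: "ideal J R" "spanned_by_homogeneous J"
  shows "spanned_by_homogeneous (I \<cdot> J)"
proof -
  let ?A = "\<Union>i. A i"
  let ?T = "additive_span R (I \<cdot> J \<inter> ?A)"
  have gens: "I \<cdot> J \<inter> ?A \<subseteq> carrier R" using ideal_prod_in_carrier[OF I(1) J(1)] by blast
  note Tadd = additive_span_add[OF gens]
  have Ic: "\<And>x. x \<in> I \<Longrightarrow> x \<in> carrier R" and Jc: "\<And>x. x \<in> J \<Longrightarrow> x \<in> carrier R"
    using ideal.Icarr[OF I(1)] ideal.Icarr[OF J(1)] by blast+
  have hom: "g \<otimes> h \<in> ?T" if "g \<in> I \<inter> ?A" "h \<in> J \<inter> ?A" for g h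
  proof -
    have "g \<otimes> h \<in> I \<cdot> J \<inter> ?A" using that mult_degree by (blast intro: ideal_prod.prod)
    then show ?thesis using additive_span_superset[OF gens] by blast
  qed
  have left: "g \<otimes> y \<in> ?T" if g: "g \<in> I \<inter> ?A" and y: "y \<in> J" for g y
  proof -
    have "additive_span R (J \<inter> ?A) \<subseteq> {y \<in> carrier R. g \<otimes> y \<in> ?T}"
      by (rule additive_span_least)
        (use g hom Ic Jc Tadd in \<open>auto simp: r_distr intro: additive_span.zero\<close>)
    then show ?thesis using y J(2) unfolding spanned_by_homogeneous_def by blast
  qed
  have prod: "x \<otimes> y \<in> ?T" if x: "x \<in> I" and y: "y \<in> J" for x y
  proof -
    have "additive_span R (I \<inter> ?A) \<subseteq> {x \<in> carrier R. x \<otimes> y \<in> ?T}"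
      by (rule additive_span_least)
        (use y left Ic Jc Tadd in \<open>auto simp: l_distr intro: additive_span.zero\<close>)
    then show ?thesis using x I(2) unfolding spanned_by_homogeneous_def by blast
  qed
  show ?thesis unfolding spanned_by_homogeneous_def
  proof
    show "s \<in> ?T" if "s \<in> I \<cdot> J" for s
      using that by induction (use prod Tadd in auto)
  qed
qed

lemma spanned_by_homogeneous_power:
  assumes "ideal I R" "spanned_by_homogeneous I"
  shows "spanned_by_homogeneous (ideal_power R I n)"
proof (induction n)
  case 0
  have "carrier R \<inter> (\<Union>i. A i) = (\<Union>i. A i)" using ring_component_closed by blast
  then show ?case
    using carrier_ring_span unfolding spanned_by_homogeneous_def ideal_power_0 by simp
next
  case (Suc n)
  then show ?case
    unfolding ideal_power_Suc by (rule spanned_by_homogeneous_prod[OF ideal_ideal_power[OF assms(1)] _ assms])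
qed

end

sublocale graded_module \<subseteq> pregraded_module R M B
proof (intro pregraded_module.intro pregraded_module_axioms.intro module_axioms)
  show "additive_subgroup (B i) M" for i
    using module_direct_sum by (simp add: direct_sum_decomp_def)
qed

context graded_module
begin

lemma carrier_module_span: "carrier M \<subseteq> additive_span M (\<Union>i. B i)"
proof
  fix x assume "x \<in> carrier M"
  then obtain f where "homogeneous_decomp M B x f"
    using module_direct_sum unfolding direct_sum_decomp_def by blast
  then show "x \<in> additive_span M (\<Union>i. B i)"
    by (rule M.homogeneous_decomp_imp_additive_span) (use component_closed in blast)
qed

lemma graded_submodule_carrier_module: "graded_submodule (carrier M) R M B"
proof -
  have "carrier M \<inter> (\<Union>i. B i) = (\<Union>i. B i)" using component_closed by blast
  then show ?thesis
    using carrier_module_span carrier_is_submodule by (simp add: graded_submodule_iff)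
qed

text \<open>As for products of ideals: first both factors homogeneous, then an arbitrary module
  element, then an arbitrary scalar.\<close>

lemma graded_submodule_ideal_smult:
  assumes I: "ideal I R" "spanned_by_homogeneous I"
  shows "graded_submodule (ideal_smult M I) R M B"
proof -
  let ?A = "\<Union>i. A i" and ?B = "\<Union>i. B i"
  let ?N = "ideal_smult M I"
  let ?T = "additive_span M (?N \<inter> ?B)"
  note N = ideal_smult_submodule[OF I(1)]
  have gens: "?N \<inter> ?B \<subseteq> carrier M" using submoduleE(1)[OF N] by blast
  note Tadd = M.additive_span_add[OF gens]
  have Ic: "\<And>x. x \<in> I \<Longrightarrow> x \<in> carrier R" using ideal.Icarr[OF I(1)] by blast
  have hom: "g \<odot>\<^bsub>M\<^esub> h \<in> ?T" if "g \<in> I \<inter> ?A" "h \<in> ?B" for g h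
  proof -
    have "g \<odot>\<^bsub>M\<^esub> h \<in> ?N \<inter> ?B"
      using that smult_degree component_closed by (blast intro: ideal_smult.prod)
    then show ?thesis using M.additive_span_superset[OF gens] by blast
  qed
  have left: "g \<odot>\<^bsub>M\<^esub> y \<in> ?T" if g: "g \<in> I \<inter> ?A" and y: "y \<in> carrier M" for g y
  proof -
    have "additive_span M ?B \<subseteq> {y \<in> carrier M. g \<odot>\<^bsub>M\<^esub> y \<in> ?T}"
      by (rule additive_span_least)
        (use g hom Ic component_closed Tadd in \<open>auto simp: smult_r_distr intro: additive_span.zero\<close>)
    then show ?thesis using y carrier_module_span by blast
  qed
  have prod: "x \<odot>\<^bsub>M\<^esub> y \<in> ?T" if x: "x \<in> I" and y: "y \<in> carrier M" for x y
  proof -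
    have "additive_span R (I \<inter> ?A) \<subseteq> {x \<in> carrier R. x \<odot>\<^bsub>M\<^esub> y \<in> ?T}"
      by (rule additive_span_least)
        (use y left Ic Tadd in \<open>auto simp: smult_l_distr intro: additive_span.zero\<close>)
    then show ?thesis using x I(2) unfolding spanned_by_homogeneous_def by blast
  qed
  have "?N \<subseteq> ?T"
  proof
    show "s \<in> ?T" if "s \<in> ?N" for s
      using that by induction (use prod Tadd in auto)
  qed
  then show ?thesis using N by (simp add: graded_submodule_iff)
qed

lemma graded_submodule_set_add:
  assumes N: "graded_submodule N R M B" and V: "graded_submodule V R M B"
  shows "graded_submodule (N <+>\<^bsub>M\<^esub> V) R M B"
proof -
  let ?B = "\<Union>i. B i" and ?S = "N <+>\<^bsub>M\<^esub> V"
  note sub = graded_submoduleD(1)[OF N] graded_submoduleD(1)[OF V]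
  note S = submodule_set_add[OF sub]
  have gens: "?S \<inter> ?B \<subseteq> carrier M" using submoduleE(1)[OF S] by blast
  have "N \<subseteq> additive_span M (?S \<inter> ?B)" "V \<subseteq> additive_span M (?S \<inter> ?B)"
    using graded_submoduleD(2)[OF N] additive_span_mono[of "N \<inter> ?B" "?S \<inter> ?B" M]
      graded_submoduleD(2)[OF V] additive_span_mono[of "V \<inter> ?B" "?S \<inter> ?B" M]
      subset_set_add[OF sub] by blast+
  then have "?S \<subseteq> additive_span M (?S \<inter> ?B)"
    using M.additive_span_add[OF gens] unfolding mem_set_add subset_iff by blast
  then show ?thesis using S by (simp add: graded_submodule_iff)
qed

text \<open>Splitting a scalar \<open>a\<close> into homogeneous parts splits \<open>a p\<close>
  into homogeneous multiples of \<open>p\<close>.\<close>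

lemma graded_submodule_cyclic:
  assumes p: "p \<in> B i"
  shows "graded_submodule ((\<lambda>a. a \<odot>\<^bsub>M\<^esub> p) ` carrier R) R M B"
proof -
  let ?V = "(\<lambda>a. a \<odot>\<^bsub>M\<^esub> p) ` carrier R" and ?B = "\<Union>i. B i"
  have pc: "p \<in> carrier M" using p component_closed by blast
  have V: "submodule ?V R M"
  proof (rule submoduleI')
    show "?V \<subseteq> carrier M" using pc by auto
    show "\<zero>\<^bsub>M\<^esub> \<in> ?V" using pc by (intro image_eqI[of _ _ \<zero>]) auto
    show "x \<oplus>\<^bsub>M\<^esub> y \<in> ?V" if "x \<in> ?V" "y \<in> ?V" for x y
      using that pc by (auto simp: smult_l_distr[symmetric])
    show "a \<odot>\<^bsub>M\<^esub> x \<in> ?V" if "a \<in> carrier R" "x \<in> ?V" for a x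
      using that pc by (auto simp: smult_assoc1[symmetric])
  qed
  have gens: "?V \<inter> ?B \<subseteq> carrier M" using submoduleE(1)[OF V] by blast
  have "additive_span R (\<Union>i. A i) \<subseteq> {a \<in> carrier R. a \<odot>\<^bsub>M\<^esub> p \<in> additive_span M (?V \<inter> ?B)}"
  proof (rule additive_span_least)
    show "(\<Union>i. A i) \<subseteq> {a \<in> carrier R. a \<odot>\<^bsub>M\<^esub> p \<in> additive_span M (?V \<inter> ?B)}"
    proof
      fix a assume "a \<in> (\<Union>i. A i)"
      then obtain k where k: "a \<in> A k" by blast
      then have "a \<odot>\<^bsub>M\<^esub> p \<in> ?V \<inter> ?B" using smult_degree[OF k p] ring_component_closed[OF k] by blast
      then show "a \<in> {a \<in> carrier R. a \<odot>\<^bsub>M\<^esub> p \<in> additive_span M (?V \<inter> ?B)}"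
        using M.additive_span_superset[OF gens] ring_component_closed[OF k] by blast
    qed
  qed (use pc M.additive_span_add[OF gens] in \<open>auto simp: smult_l_distr intro: additive_span.zero\<close>)
  then have "?V \<subseteq> additive_span M (?V \<inter> ?B)" using carrier_ring_span by blast
  then show ?thesis using V by (simp add: graded_submodule_iff)
qed

text \<open>Comparing components of degree \<open>i\<close>: the decomposition of \<open>x\<close> along the components
  of \<open>M\<close>, with \<open>B i\<close> shrunk to \<open>N \<inter> B i\<close>, must be the trivial one.\<close>

lemma homogeneous_mem_by_degree:
  assumes N: "graded_submodule N R M B" and x: "x \<in> B i" and n: "n \<in> N"
    and y: "y \<in> additive_span M (\<Union>k\<in>{i<..}. B k)" and eq: "x = n \<oplus>\<^bsub>M\<^esub> y"
  shows "x \<in> N"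
proof -
  define B' where "B' k = (if k = i then N \<inter> B i else B k)" for k
  note Ns = graded_submoduleD(1)[OF N]
  have sg: "additive_subgroup (B' k) M" for k
    using M.additive_subgroup_Int[OF submodule_additive_subgroup[OF Ns] component_subgroup]
      component_subgroup by (simp add: B'_def)
  have gens: "(\<Union>k. B' k) \<subseteq> carrier M" using additive_subgroup.a_subset[OF sg] by blast
  have "N \<inter> (\<Union>k. B k) \<subseteq> (\<Union>k. B' k)" by (auto simp: B'_def)
  then have "n \<in> additive_span M (\<Union>k. B' k)"
    using n graded_submoduleD(2)[OF N] additive_span_mono by blast
  moreover have "(\<Union>k\<in>{i<..}. B k) \<subseteq> (\<Union>k. B' k)" by (force simp: B'_def)
  then have "y \<in> additive_span M (\<Union>k. B' k)" using y additive_span_mono by blast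
  ultimately have "x \<in> additive_span M (\<Union>k. B' k)"
    unfolding eq by (rule M.additive_span_add[OF gens])
  then obtain f where f: "homogeneous_decomp M B' x f"
    using M.additive_span_imp_homogeneous_decomp[of x B'] sg by blast
  have xc: "x \<in> carrier M" using x component_closed by blast
  have B'B: "B' k \<subseteq> B k" for k by (auto simp: B'_def)
  then have "homogeneous_decomp M B x f" using f unfolding homogeneous_decomp_def by blast
  moreover have "homogeneous_decomp M B x (\<lambda>k. if k = i then x else \<zero>\<^bsub>M\<^esub>)"
  proof (cases "x = \<zero>\<^bsub>M\<^esub>")
    case True
    then show ?thesis
      using additive_subgroup.zero_closed[OF component_subgroup] by (simp add: homogeneous_decomp_def)
  next
    case False
    then have "{k. (if k = i then x else \<zero>\<^bsub>M\<^esub>) \<noteq> \<zero>\<^bsub>M\<^esub>} = {i}" by auto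
    moreover have "(\<Oplus>\<^bsub>M\<^esub>k\<in>{i}. if k = i then x else \<zero>\<^bsub>M\<^esub>) = x"
      using xc M.finsum_insert[of "{}" i "\<lambda>k. if k = i then x else \<zero>\<^bsub>M\<^esub>"] by simp
    ultimately show ?thesis
      using x additive_subgroup.zero_closed[OF component_subgroup] by (simp add: homogeneous_decomp_def)
  qed
  ultimately have "f = (\<lambda>k. if k = i then x else \<zero>\<^bsub>M\<^esub>)"
    using module_direct_sum xc unfolding direct_sum_decomp_def by blast
  then have "f i = x" by simp
  moreover have "f i \<in> B' i" using f by (simp add: homogeneous_decomp_def)
  ultimately show ?thesis by (simp add: B'_def)
qed

end

section \<open>Graded and ordinary length over a positively graded ring\<close>

locale positively_graded_module = positively_graded_ring R A + graded_module R A M B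
  for R (structure) and A and M (structure) and B
begin

text \<open>Positivity enters here: nonzero homogeneous scalars have degree at least 0, so
  multiplication never leaves the degrees above \<open>i\<close>.\<close>

lemma graded_submodule_truncation:
  assumes P: "submodule P R M"
  shows "graded_submodule (additive_span M (\<Union>k\<in>{i<..}. P \<inter> B k)) R M B"
proof -
  let ?G = "\<Union>k\<in>{i<..}. P \<inter> B k"
  let ?V = "additive_span M ?G"
  have gens: "?G \<subseteq> carrier M" using submoduleE(1)[OF P] by blast
  note Vadd = M.additive_span_add[OF gens]
  have Vc: "?V \<subseteq> carrier M" using M.additive_span_closed[OF gens] by blast
  have hom: "a \<odot>\<^bsub>M\<^esub> g \<in> ?V" if a: "a \<in> A j" and g: "g \<in> ?G" for a g j
  proof (cases "j < 0")
    case True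
    then have "a = \<zero>" using a negative_degree by auto
    then have "a \<odot>\<^bsub>M\<^esub> g = \<zero>\<^bsub>M\<^esub>" using g gens by (simp only: smult_l_null subset_iff)
    then show ?thesis using additive_span.zero by metis
  next
    case False
    obtain k where k: "k > i" "g \<in> P" "g \<in> B k" using g by auto
    have "a \<odot>\<^bsub>M\<^esub> g \<in> P \<inter> B (j + k)"
      using smult_degree[OF a k(3)] submoduleE(4)[OF P ring_component_closed[OF a] k(2)] by blast
    moreover have "j + k \<in> {i<..}" using k(1) False by simp
    ultimately show ?thesis using M.additive_span_superset[OF gens] by blast
  qed
  have hom': "a \<odot>\<^bsub>M\<^esub> v \<in> ?V" if a: "a \<in> A j" and v: "v \<in> ?V" for a v j
  proof -
    have "?V \<subseteq> {v \<in> carrier M. a \<odot>\<^bsub>M\<^esub> v \<in> ?V}"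
      by (rule additive_span_least)
        (use hom[OF a] gens ring_component_closed[OF a] Vadd in
          \<open>auto simp: smult_r_distr intro: additive_span.zero\<close>)
    then show ?thesis using v by blast
  qed
  have "submodule ?V R M"
  proof (rule submoduleI'[OF Vc additive_span.zero Vadd])
    fix a v assume a: "a \<in> carrier R" and v: "v \<in> ?V"
    have "additive_span R (\<Union>i. A i) \<subseteq> {a \<in> carrier R. a \<odot>\<^bsub>M\<^esub> v \<in> ?V}"
      by (rule additive_span_least)
        (use hom'[OF _ v] subsetD[OF Vc v] ring_component_closed Vadd in
          \<open>auto simp: smult_l_distr intro: additive_span.zero\<close>)
    then show "a \<odot>\<^bsub>M\<^esub> v \<in> ?V" using a carrier_ring_span by blast
  qed
  moreover have "?V \<subseteq> additive_span M (?V \<inter> (\<Union>i. B i))"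
    by (rule additive_span_mono) (use M.additive_span_superset[OF gens] in blast)
  ultimately show ?thesis by (simp add: graded_submodule_iff)
qed

text \<open>A *simple factor \<open>P / N\<close> lives in a single degree: the part of \<open>P\<close> above the degree of
  a homogeneous \<open>x \<in> P - N\<close> spans, together with \<open>N\<close>, a graded submodule missing \<open>x\<close>.\<close>

lemma covers_degree:
  assumes cov: "covers (graded_submodules R M B) N P"
    and x: "x \<in> P" "x \<in> B i" "x \<notin> N" and ki: "k > i"
  shows "P \<inter> B k \<subseteq> N"
proof -
  have N: "graded_submodule N R M B" and P: "graded_submodule P R M B" and NP: "N \<subseteq> P"
    and between: "\<And>Y. graded_submodule Y R M B \<Longrightarrow> N \<subseteq> Y \<Longrightarrow> Y \<subseteq> P \<Longrightarrow> Y = N \<or> Y = P"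
    using cov by (auto simp: covers_def)
  note Ns = graded_submoduleD(1)[OF N] and Ps = graded_submoduleD(1)[OF P]
  let ?G = "\<Union>k\<in>{i<..}. P \<inter> B k"
  let ?V = "additive_span M ?G"
  note V = graded_submodule_truncation[OF Ps, of i]
  note sums = subset_set_add[OF Ns graded_submoduleD(1)[OF V]]
  have "?V \<subseteq> P" by (rule additive_span_submodule_least[OF Ps]) blast
  then have "N <+>\<^bsub>M\<^esub> ?V \<subseteq> P" using NP by (intro set_add_subset[OF Ps])
  moreover have "x \<notin> N <+>\<^bsub>M\<^esub> ?V"
  proof
    assume "x \<in> N <+>\<^bsub>M\<^esub> ?V"
    then obtain n v where nv: "n \<in> N" "v \<in> ?V" "x = n \<oplus>\<^bsub>M\<^esub> v" unfolding mem_set_add by blast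
    have "v \<in> additive_span M (\<Union>k\<in>{i<..}. B k)"
      using nv(2) additive_span_mono[of ?G "\<Union>k\<in>{i<..}. B k" M] by blast
    then show False using homogeneous_mem_by_degree[OF N x(2) nv(1) _ nv(3)] x(3) by blast
  qed
  ultimately have "N <+>\<^bsub>M\<^esub> ?V = N"
    using between[OF graded_submodule_set_add[OF N V] sums(1)] x(1) by blast
  moreover have "P \<inter> B k \<subseteq> ?V"
  proof -
    have "?G \<subseteq> carrier M" using submoduleE(1)[OF Ps] by blast
    then show ?thesis using M.additive_span_superset[of ?G] ki by blast
  qed
  ultimately show ?thesis using sums(2) by blast
qed

text \<open>By \<open>covers_degree\<close> the factor \<open>P / N\<close> sits in one degree, so
  modulo \<open>N\<close> every element of \<open>P\<close> is homogeneous. An ungraded intermediate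
  submodule therefore contains a graded one larger than \<open>N\<close>.\<close>

lemma covers_graded_imp_covers:
  assumes cov: "covers (graded_submodules R M B) N P"
  shows "covers submodules N P"
proof -
  have N: "graded_submodule N R M B" and P: "graded_submodule P R M B" and NP: "N \<subset> P"
    and between: "\<And>Y. graded_submodule Y R M B \<Longrightarrow> N \<subseteq> Y \<Longrightarrow> Y \<subseteq> P \<Longrightarrow> Y = N \<or> Y = P"
    using cov by (auto simp: covers_def)
  note Ns = graded_submoduleD(1)[OF N] and Ps = graded_submoduleD(1)[OF P]
  have "\<not> P \<inter> (\<Union>i. B i) \<subseteq> N"
    using additive_span_submodule_least[OF Ns] graded_submoduleD(2)[OF P] NP by blast
  then obtain x i where x: "x \<in> P" "x \<in> B i" "x \<notin> N" by blast
  have deg: "P \<inter> B k \<subseteq> N" if "k \<noteq> i" for k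
  proof
    fix z assume z: "z \<in> P \<inter> B k"
    show "z \<in> N"
    proof (rule ccontr)
      assume zN: "z \<notin> N"
      show False
      proof (cases "k > i")
        case True
        then show False using covers_degree[OF cov x] z zN by blast
      next
        case False
        \<comment> \<open>Here \<open>x\<close> and \<open>z\<close> exchange roles: with
          \<open>z\<close> as the homogeneous element outside \<open>N\<close>, the higher degree
          \<open>i\<close> would be contained in \<open>N\<close>.\<close>
        then have "i > k" using that by simp
        then show False using covers_degree[OF cov _ _ zN, of k i] z x by blast
      qed
    qed
  qed
  \<comment> \<open>\<open>P \<inter> B i\<close> is only an additive subgroup, so closure of
    \<open>?H\<close> under addition is checked by hand.\<close>
  let ?H = "N <+>\<^bsub>M\<^esub> (P \<inter> B i)"
  interpret PBi: additive_subgroup "P \<inter> B i" M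
    by (rule M.additive_subgroup_Int[OF submodule_additive_subgroup[OF Ps] component_subgroup])
  have Nc: "\<And>n. n \<in> N \<Longrightarrow> n \<in> carrier M" using submoduleE(1)[OF Ns] by blast
  have H: "P \<subseteq> ?H"
  proof -
    have "additive_span M (P \<inter> (\<Union>i. B i)) \<subseteq> ?H"
    proof (rule additive_span_least)
      show "\<zero>\<^bsub>M\<^esub> \<in> ?H"
        unfolding mem_set_add using submodule_zero[OF Ns] PBi.zero_closed
        by (intro bexI[of _ "\<zero>\<^bsub>M\<^esub>"]) auto
      show "P \<inter> (\<Union>i. B i) \<subseteq> ?H"
      proof
        fix g assume "g \<in> P \<inter> (\<Union>i. B i)"
        then obtain k where k: "g \<in> P" "g \<in> B k" by blast
        have gc: "g \<in> carrier M" using k component_closed by blast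
        show "g \<in> ?H"
        proof (cases "k = i")
          case True
          then show ?thesis unfolding mem_set_add
            using submodule_zero[OF Ns] k gc
            by (intro bexI[of _ "\<zero>\<^bsub>M\<^esub>"] bexI[of _ g]) auto
        next
          case False
          then have "g \<in> N" using deg k by blast
          then show ?thesis unfolding mem_set_add
            using PBi.zero_closed gc by (intro bexI[of _ g] bexI[of _ "\<zero>\<^bsub>M\<^esub>"]) auto
        qed
      qed
      fix u v assume "u \<in> ?H" "v \<in> ?H"
      then obtain n p n' p' where np: "n \<in> N" "p \<in> P \<inter> B i" "n' \<in> N" "p' \<in> P \<inter> B i"
        "u = n \<oplus>\<^bsub>M\<^esub> p" "v = n' \<oplus>\<^bsub>M\<^esub> p'" unfolding mem_set_add by blast
      have "u \<oplus>\<^bsub>M\<^esub> v = (n \<oplus>\<^bsub>M\<^esub> n') \<oplus>\<^bsub>M\<^esub> (p \<oplus>\<^bsub>M\<^esub> p')"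
        using np(5,6) Nc[OF np(1)] Nc[OF np(3)] PBi.a_Hcarr[OF np(2)] PBi.a_Hcarr[OF np(4)]
        by (simp add: M.a_ac)
      then show "u \<oplus>\<^bsub>M\<^esub> v \<in> ?H"
        unfolding mem_set_add using submoduleE(5)[OF Ns np(1,3)] PBi.a_closed[OF np(2,4)] by blast
    qed
    then show ?thesis using graded_submoduleD(2)[OF P] by blast
  qed
  have "Y = N \<or> Y = P" if Y: "submodule Y R M" "N \<subseteq> Y" "Y \<subseteq> P" for Y
  proof (rule ccontr)
    assume ne: "\<not> (Y = N \<or> Y = P)"
    then obtain y where y: "y \<in> Y" "y \<notin> N" using Y(2) by blast
    \<comment> \<open>The homogeneous part \<open>p\<close> again lies in \<open>Y\<close> but not
      in \<open>N\<close>, so the graded submodule \<open>N + R p\<close> is larger than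
      \<open>N\<close> and contained in \<open>Y\<close>; it must be \<open>P\<close>.\<close>
    obtain n p where np: "n \<in> N" "p \<in> P" "p \<in> B i" "y = n \<oplus>\<^bsub>M\<^esub> p"
      using y(1) Y(3) H unfolding subset_iff mem_set_add by blast
    have pc: "p \<in> carrier M" using np component_closed by blast
    have "p = y \<ominus>\<^bsub>M\<^esub> n"
      using np(4) pc Nc[OF np(1)] M.a_comm[of n p] by (simp add: M.minus_eq M.a_assoc M.r_neg)
    then have pY: "p \<in> Y" using submodule_minus[OF Y(1) y(1)] np(1) Y(2) by blast
    have pN: "p \<notin> N" using y(2) np(4) submoduleE(5)[OF Ns np(1)] by blast
    let ?V = "(\<lambda>a. a \<odot>\<^bsub>M\<^esub> p) ` carrier R"
    note V = graded_submodule_cyclic[OF np(3)]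
    note sums = subset_set_add[OF Ns graded_submoduleD(1)[OF V]]
    have "p \<in> ?V" using pc by (intro image_eqI[of _ _ \<one>]) auto
    then have "N <+>\<^bsub>M\<^esub> ?V \<noteq> N" using sums(2) pN by blast
    moreover have sub: "N <+>\<^bsub>M\<^esub> ?V \<subseteq> Y"
      using Y(2) submoduleE(4)[OF Y(1) _ pY] by (intro set_add_subset[OF Y(1)]) auto
    ultimately have "N <+>\<^bsub>M\<^esub> ?V = P"
      using between[OF graded_submodule_set_add[OF N V] sums(1)] Y(3) by blast
    then show False using sub Y(3) ne by blast
  qed
  then show ?thesis using Ns Ps NP by (auto simp: covers_def)
qed

lemma has_length_graded_imp_has_length:
  assumes "has_length (graded_submodules R M B) N P n"
  shows "has_length submodules N P n"
  using assms
  by induction (auto intro: has_length.intros covers_graded_imp_covers graded_submoduleD(1))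

text \<open>A graded saturated chain exists because the rank restricts to graded submodules. It is
  also an ungraded saturated chain, so uniqueness fixes its length.\<close>

lemma has_length_imp_has_length_graded:
  assumes "has_length submodules N P n" "graded_submodule N R M B" "graded_submodule P R M B"
  shows "has_length (graded_submodules R M B) N P n"
proof -
  obtain m where m: "has_length (graded_submodules R M B) N P m"
    using has_length_exists_subfamily[OF assms(1), of "graded_submodules R M B" N P]
      assms(2,3) has_length_mem[OF assms(1)] graded_submoduleD(1) by blast
  then have "m = n"
    using has_length_unique[OF has_length_graded_imp_has_length assms(1)] by blast
  then show ?thesis using m by simp
qed

text \<open>Both definite descriptions are evaluated at the same number: the admissible lengths of
  either kind of series are exactly \<open>n\<close>.\<close>

lemma length_quot:
  assumes "graded_submodule N R M B" "has_length submodules N (carrier M) n"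
  shows "module_length R (quot_module M N) = enat n"
    and "star_length R (quot_module M N) (quot_grading M N B) = enat n"
proof -
  have "(\<exists>C. composition_series R (quot_module M N) C m) \<longleftrightarrow> m = n" for m
    unfolding composition_series_quot_iff[OF graded_submoduleD(1)[OF assms(1)]]
    using assms(2) has_length_unique by blast
  then show "module_length R (quot_module M N) = enat n"
    by (simp add: module_length_def)
  have "(\<exists>C. star_composition_series R (quot_module M N) (quot_grading M N B) C m) \<longleftrightarrow> m = n" for m
    unfolding star_composition_series_quot_iff[OF assms(1)]
    using has_length_imp_has_length_graded[OF assms(2,1) graded_submodule_carrier_module]
      has_length_unique[OF has_length_graded_imp_has_length assms(2)] by blast
  then show "star_length R (quot_module M N) (quot_grading M N B) = enat n"
    by (simp add: star_length_def)
qed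

end

theorem theorem7p8:
  fixes R :: "('a, 'r) ring_scheme" and A :: "int \<Rightarrow> 'a set"
    and M :: "('a, 'b, 'm) module_scheme" and B :: "int \<Rightarrow> 'b set"
    and I :: "'a set"
  assumes "positively_graded_ring R A"
    and "noetherian_ring R"
    and "artinian_ring (R\<lparr>carrier := A 0\<rparr>)"
    and "graded_module R A M B"
    and "finitely_generated_module R M"
    and "graded_ideal_of_definition R A M B I"
  shows "(\<exists>!p. is_star_samuel_poly R M B I p)
    \<and> length_mod R M I < \<infinity>
    \<and> (\<exists>!p. is_samuel_poly R M I p)
    \<and> star_samuel_poly R M B I = samuel_poly R M I
    \<and> (\<forall>d. degree (star_samuel_poly R M B I) \<le> d \<and> degree (samuel_poly R M I) \<le> d \<longrightarrow>
          star_multiplicity_e R M B I d = multiplicity_e R M I d)"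
proof -
  interpret positively_graded_module R A M B
    using assms(1,4) by (simp add: positively_graded_module_def)
  interpret noetherian_ring R by fact
  have I: "graded_ideal I R A" "ideal I R" "star_length_mod R M B I < \<infinity>"
    using assms(6) by (auto simp: graded_ideal_of_definition_def graded_ideal_def)
  note hom = graded_ideal_spanned[OF I(1)]
  note gI = graded_submodule_ideal_smult[OF I(2) hom]
  have gIn: "graded_submodule (ideal_smult M (ideal_power R I n)) R M B" for n
    by (rule graded_submodule_ideal_smult[OF ideal_ideal_power[OF I(2)]
          spanned_by_homogeneous_power[OF I(2) hom]])
  \<comment> \<open>\<open>star_length\<close> is infinite by definition when there is no series, so
    finiteness provides one.\<close>
  obtain l where "has_length (graded_submodules R M B) (ideal_smult M I) (carrier M) l"
    using I(3) star_composition_series_quot_iff[OF gI] by (auto simp: star_length_def split: if_splits)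
  then have l: "has_length submodules (ideal_smult M I) (carrier M) l"
    by (rule has_length_graded_imp_has_length)
  \<comment> \<open>The Noetherian hypothesis supplies the finite list of generators over which the
    monomials are formed.\<close>
  obtain X where "X \<subseteq> carrier R" "finite X" "I = Idl\<^bsub>R\<^esub> X"
    using finetely_gen[OF I(2)] by blast
  then obtain as where as: "set as \<subseteq> carrier R" "I = Idl\<^bsub>R\<^esub> (set as)"
    using finite_list by metis
  obtain L where L: "eventually_polynomial L"
    and len: "\<And>n. has_length submodules (ideal_smult M (ideal_power R I n)) (carrier M) (L n)"
    using hilbert_samuel[OF as l] by blast
  have eq: "length_mod R M (ideal_power R I n) = enat (L n)"
    "star_length_mod R M B (ideal_power R I n) = enat (L n)" for n
    using length_quot[OF gIn len] by auto
  obtain p where p: "eventually_poly (\<lambda>n. enat (L n)) p"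
    using L by (auto simp: eventually_polynomial_def eventually_poly_def)
  \<comment> \<open>The two length functions agree at every \<open>n\<close>, so the two predicates
    coincide, and with them the polynomials they describe.\<close>
  have same: "is_star_samuel_poly R M B I = is_samuel_poly R M I"
    by (simp add: fun_eq_iff is_star_samuel_poly_def is_samuel_poly_def eq)
  have ex1: "\<exists>!p. is_samuel_poly R M I p"
    unfolding is_samuel_poly_def eq using p eventually_poly_unique by blast
  have polys: "star_samuel_poly R M B I = samuel_poly R M I"
    by (simp add: star_samuel_poly_def samuel_poly_def same)
  show ?thesis
    using ex1 length_quot(1)[OF gI l] polys
    by (simp add: same star_multiplicity_e_def multiplicity_e_def)
qed

end
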